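(* Let $\mathcal{G}$ be a locally compact abelian group with dual group $\hat{\mathcal{G}}$, and let $w$ be a submultiplicative weight on $\hat{\mathcal{G}}$ satisfying the Beurling–Domar condition and $w^{-1}\in L^2(\hat{\mathcal{G}})$. Put $\phi=\mathcal{F}^{-1}(w^{-2})$. Then $\mathcal{H}_w(\mathcal{G})$ is a reproducing kernel Hilbert space whose kernel is $k(x,y)=k_x(y)=\phi(y-x)$, i.e. $k_x=T_x\phi\in\mathcal{H}_w(\mathcal{G})$ and $$f(x)=\langle f,T_x\phi\rangle_w\qquad\text{for all } f\in\mathcal{H}_w(\mathcal{G})\text{ and } x\in\mathcal{G}.$$
   Context: Conventions. $\mathcal{G}$ is a locally compact abelian group (written additively), and $\hat{\mathcal{G}}$ is its dual group (also written additively). The pairing is $\langle \gamma,x\rangle=\langle x,\gamma\rangle=\gamma(x)$. Haar measures $dx$, $d\gamma$ are normalized so that Fourier inversion and Plancherel hold, with $\mathcal{F}f(\gamma)=\hat f(\gamma)=\int_{\mathcal{G}} f(x)\overline{\gamma(x)}\,dx$ and $\mathcal{F}^{-1}h(x)=\int_{\hat{\mathcal{G}}}h(\gamma)\langle\gamma,x\rangle\,d\gamma$. Translation: $T_xf(y)=f(y-x)$. Weights. A submultiplicative weight is a strictly positive continuous function $w$ on $\hat{\mathcal{G}}$ with $w(\gamma_1+\gamma_2)\le w(\gamma_1)w(\gamma_2)$ for all $\gamma_1,\gamma_2\in\hat{\mathcal{G}}$. The Beurling–Domar condition is $\sum_{n=1}^\infty n^{-2}\log w(n\gamma)<\infty$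 for all $\gamma\in\hat{\mathcal{G}}$. Harmonic Hilbert space. $L^2_w(\hat{\mathcal{G}})$ is the space of measurable $h$ with $hw\in L^2(\hat{\mathcal{G}})$; $\mathcal{H}_w(\mathcal{G})=\mathcal{F}^{-1}L^2_w(\hat{\mathcal{G}})$ with inner product $\langle f,g\rangle_w=\int_{\hat{\mathcal{G}}}\hat f(\gamma)\overline{\hat g(\gamma)}w^2(\gamma)\,d\gamma$. Since $w^{-1}\in L^2$, we have $L^2_w\subset L^1$ and elements of $\mathcal{H}_w(\mathcal{G})$ are continuous functions. A reproducing kernel Hilbert space is a Hilbert space of continuous functions on which all point evaluations are continuous; its kernel is $k(x,y)=k_x(y)$, where $k_x$ is the unique element with $f(x)=\langle f,k_x\rangle$ for all $f$. *)

theory Defs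
  imports "HOL-Analysis.Analysis"
begin

section \<open>The dual group\<close>

typedef (overloaded) ('a::topological_ab_group_add) dual_group =
  "{c :: 'a \<Rightarrow> complex. continuous_on UNIV c \<and> (\<forall>x. cmod (c x) = 1) \<and>
     (\<forall>x y. c (x + y) = c x * c y)}"
  morphisms pairing Abs_dual_group
  by (rule exI[of _ "\<lambda>_. 1"]) auto

setup_lifting type_definition_dual_group

lemma pairing_norm [simp]: "cmod (pairing c x) = 1"
  using pairing[of c] by auto

lemma pairing_continuous: "continuous_on UNIV (pairing c)"
  using pairing[of c] by auto

lemma pairing_add_right: "pairing c (x + y) = pairing c x * pairing c y"
  using pairing[of c] by auto

text \<open>The dual group is written additively: its operations are the pointwise product and
  the pointwise conjugate of characters.\<close>

instantiation dual_group :: (topological_ab_group_add) ab_group_add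
begin

lift_definition zero_dual_group :: "'a dual_group" is "\<lambda>_. 1"
  by auto

lift_definition plus_dual_group :: "'a dual_group \<Rightarrow> 'a dual_group \<Rightarrow> 'a dual_group"
  is "\<lambda>c d x. c x * d x"
  by (auto intro!: continuous_intros simp: norm_mult)

lift_definition uminus_dual_group :: "'a dual_group \<Rightarrow> 'a dual_group" is "\<lambda>c x. cnj (c x)"
  by (auto intro!: continuous_intros)

definition minus_dual_group :: "'a dual_group \<Rightarrow> 'a dual_group \<Rightarrow> 'a dual_group"
  where "minus_dual_group c d = c + - d"

instance
proof
  fix a b c :: "'a dual_group"
  show "a + b + c = a + (b + c)" by transfer (simp add: mult.assoc)
  show "a + b = b + a" by transfer (simp add: mult.commute)
  show "0 + a = a" by transfer simp
  show "- a + a = 0"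
    by transfer (auto simp: mult.commute[of "cnj _"] complex_norm_square[symmetric])
  show "a - b = a + - b" by (rule minus_dual_group_def)
qed

end

text \<open>The topology is that of uniform convergence on compact sets.\<close>

instantiation dual_group :: (topological_ab_group_add) topological_space
begin

definition open_dual_group :: "'a dual_group set \<Rightarrow> bool" where
  "open_dual_group S \<longleftrightarrow>
     (\<forall>c\<in>S. \<exists>K e. compact K \<and> e > 0 \<and>
        (\<forall>d. (\<forall>x\<in>K. cmod (pairing d x - pairing c x) < e) \<longrightarrow> d \<in> S))"

lemma open_dual_groupE:
  fixes S :: "'a dual_group set"
  assumes "open S" "c \<in> S"
  obtains K e where "compact K" "e > 0"
    "\<forall>d. (\<forall>x\<in>K. cmod (pairing d x - pairing c x) < e) \<longrightarrow> d \<in> S"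
proof -
  from bspec[OF assms(1)[unfolded open_dual_group_def] assms(2)]
  show thesis
    by (elim exE conjE) (rule that; assumption)
qed

lemma open_dual_groupI:
  fixes S :: "'a dual_group set"
  assumes "\<And>c. c \<in> S \<Longrightarrow> \<exists>K e. compact K \<and> e > 0 \<and>
        (\<forall>d. (\<forall>x\<in>K. cmod (pairing d x - pairing c x) < e) \<longrightarrow> d \<in> S)"
  shows "open S"
  unfolding open_dual_group_def by (rule ballI, rule assms)

instance
proof
  show "open (UNIV :: 'a dual_group set)"
    by (rule open_dual_groupI, rule exI[of _ "{}"], rule exI[of _ 1]) simp
next
  fix S T :: "'a dual_group set"
  assume S: "open S" and T: "open T"
  show "open (S \<inter> T)"
  proof (rule open_dual_groupI)
    fix c assume c: "c \<in> S \<inter> T"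
    obtain K e where K: "compact K" "e > 0"
      "\<forall>d. (\<forall>x\<in>K. cmod (pairing d x - pairing c x) < e) \<longrightarrow> d \<in> S"
      by (rule open_dual_groupE[OF S IntD1[OF c]])
    obtain L r where L: "compact L" "r > 0"
      "\<forall>d. (\<forall>x\<in>L. cmod (pairing d x - pairing c x) < r) \<longrightarrow> d \<in> T"
      by (rule open_dual_groupE[OF T IntD2[OF c]])
    have "d \<in> S \<inter> T"
      if "\<forall>x\<in>K \<union> L. cmod (pairing d x - pairing c x) < min e r" for d
    proof
      have *: "cmod (pairing d x - pairing c x) < min e r" if "x \<in> K \<union> L" for x
        using \<open>\<forall>x\<in>K \<union> L. _ x\<close> that by (rule bspec)
      show "d \<in> S" by (rule K(3)[rule_format]) (use * in force)
      show "d \<in> T" by (rule L(3)[rule_format]) (use * in force)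
    qed
    moreover have "compact (K \<union> L)" "min e r > 0"
      using K(1,2) L(1,2) by (simp_all add: compact_Un)
    ultimately show "\<exists>K e. compact K \<and> e > 0 \<and>
        (\<forall>d. (\<forall>x\<in>K. cmod (pairing d x - pairing c x) < e) \<longrightarrow> d \<in> S \<inter> T)"
      by (intro exI[of _ "K \<union> L"] exI[of _ "min e r"] conjI allI impI)
  qed
next
  fix \<U> :: "'a dual_group set set"
  assume U: "\<forall>S\<in>\<U>. open S"
  show "open (\<Union>\<U>)"
  proof (rule open_dual_groupI)
    fix c assume "c \<in> \<Union>\<U>"
    then obtain S where S: "S \<in> \<U>" "c \<in> S" by (rule UnionE)
    have "open S" using U S(1) by (rule bspec)
    obtain K e where K: "compact K" "e > 0"
      "\<forall>d. (\<forall>x\<in>K. cmod (pairing d x - pairing c x) < e) \<longrightarrow> d \<in> S"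
      by (rule open_dual_groupE[OF \<open>open S\<close> S(2)])
    have "d \<in> \<Union>\<U>" if "\<forall>x\<in>K. cmod (pairing d x - pairing c x) < e" for d
      by (rule UnionI[OF S(1)]) (rule mp[OF spec[OF K(3)] that])
    then show "\<exists>K e. compact K \<and> e > 0 \<and>
        (\<forall>d. (\<forall>x\<in>K. cmod (pairing d x - pairing c x) < e) \<longrightarrow> d \<in> \<Union>\<U>)"
      using K(1,2) by (intro exI[of _ K] exI[of _ e] conjI allI impI)
  qed
qed

end

lemma open_dual_nbhd:
  fixes c :: "'a::topological_ab_group_add dual_group"
  assumes K: "compact K"
  shows "open {d. \<forall>x\<in>K. cmod (pairing d x - pairing c x) < e}"
proof (rule open_dual_groupI)
  fix d assume "d \<in> {d. \<forall>x\<in>K. cmod (pairing d x - pairing c x) < e}"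
  then have d: "\<And>x. x \<in> K \<Longrightarrow> cmod (pairing d x - pairing c x) < e" by blast
  show "\<exists>L r. compact L \<and> r > 0 \<and>
     (\<forall>d'. (\<forall>x\<in>L. cmod (pairing d' x - pairing d x) < r) \<longrightarrow>
        d' \<in> {d. \<forall>x\<in>K. cmod (pairing d x - pairing c x) < e})"
  proof (cases "K = {}")
    case True
    then show ?thesis by (intro exI[of _ "{}"] exI[of _ 1]) auto
  next
    case False
    have "continuous_on K (\<lambda>x. cmod (pairing d x - pairing c x))"
      by (intro continuous_intros continuous_on_subset[OF pairing_continuous]) auto
    then obtain m where m: "m \<in> K"
      "\<And>x. x \<in> K \<Longrightarrow> cmod (pairing d x - pairing c x) \<le> cmod (pairing d m - pairing c m)"
      using continuous_attains_sup[OF K False] by blast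
    define r where "r = e - cmod (pairing d m - pairing c m)"
    have "cmod (pairing d' x - pairing c x) < e"
      if "cmod (pairing d' x - pairing d x) < r" "x \<in> K" for d' x
      using norm_triangle_ineq[of "pairing d' x - pairing d x" "pairing d x - pairing c x"]
        that m(2)[OF that(2)] by (simp add: r_def)
    then show ?thesis
      using K d[OF m(1)] by (intro exI[of _ K] exI[of _ r]) (auto simp: r_def)
  qed
qed

lemma tendsto_dual_group_iff:
  fixes c :: "'a::topological_ab_group_add dual_group"
  shows "(f \<longlongrightarrow> c) F \<longleftrightarrow>
    (\<forall>K e. compact K \<longrightarrow> e > 0 \<longrightarrow> (\<forall>\<^sub>F y in F. \<forall>x\<in>K. cmod (pairing (f y) x - pairing c x) < e))"
proof
  assume f: "(f \<longlongrightarrow> c) F"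
  show "\<forall>K e. compact K \<longrightarrow> e > 0 \<longrightarrow>
      (\<forall>\<^sub>F y in F. \<forall>x\<in>K. cmod (pairing (f y) x - pairing c x) < e)"
  proof (intro allI impI)
    fix K :: "'a set" and e :: real assume K: "compact K" and e: "e > 0"
    have "c \<in> {d. \<forall>x\<in>K. cmod (pairing d x - pairing c x) < e}" using e by simp
    from topological_tendstoD[OF f open_dual_nbhd[OF K] this]
    show "\<forall>\<^sub>F y in F. \<forall>x\<in>K. cmod (pairing (f y) x - pairing c x) < e" by simp
  qed
next
  assume *: "\<forall>K e. compact K \<longrightarrow> e > 0 \<longrightarrow>
      (\<forall>\<^sub>F y in F. \<forall>x\<in>K. cmod (pairing (f y) x - pairing c x) < e)"
  show "(f \<longlongrightarrow> c) F"
  proof (rule topological_tendstoI)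
    fix S assume S: "open S" "c \<in> S"
    obtain K e where K: "compact K" "e > 0"
      "\<forall>d. (\<forall>x\<in>K. cmod (pairing d x - pairing c x) < e) \<longrightarrow> d \<in> S"
      by (rule open_dual_groupE[OF S])
    have "\<forall>\<^sub>F y in F. \<forall>x\<in>K. cmod (pairing (f y) x - pairing c x) < e"
      using *[rule_format, OF K(1,2)] .
    then show "\<forall>\<^sub>F y in F. f y \<in> S"
      by (rule eventually_mono) (erule mp[OF spec[OF K(3)]])
  qed
qed

instance dual_group :: (topological_ab_group_add) t2_space
proof
  fix c d :: "'a dual_group"
  assume "c \<noteq> d"
  then obtain x where x: "pairing c x \<noteq> pairing d x"
    by (metis pairing_inject ext)
  define e where "e = cmod (pairing c x - pairing d x) / 2"
  define U where "U = {b. \<forall>y\<in>{x}. cmod (pairing b y - pairing c y) < e}"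
  define V where "V = {b. \<forall>y\<in>{x}. cmod (pairing b y - pairing d y) < e}"
  have e: "e > 0" using x by (simp add: e_def)
  have "open U" "open V" unfolding U_def V_def by (rule open_dual_nbhd, simp)+
  moreover have "c \<in> U" "d \<in> V" using e by (auto simp: U_def V_def)
  moreover have "U \<inter> V = {}"
  proof -
    have False if "b \<in> U" "b \<in> V" for b
    proof -
      have "cmod (pairing c x - pairing d x) \<le>
          cmod (pairing b x - pairing c x) + cmod (pairing b x - pairing d x)"
        by (metis norm_minus_commute norm_diff_triangle_le order_refl)
      then show False using that by (simp add: U_def V_def e_def)
    qed
    then show ?thesis by blast
  qed
  ultimately show "\<exists>U V. open U \<and> open V \<and> c \<in> U \<and> d \<in> V \<and> U \<inter> V = {}" by blast
qed

instance dual_group :: (topological_ab_group_add) topological_ab_group_add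
proof
  fix a b :: "'a dual_group"
  show "((\<lambda>z. fst z + snd z) \<longlongrightarrow> a + b) (nhds a \<times>\<^sub>F nhds b)"
    unfolding tendsto_dual_group_iff
  proof (intro allI impI)
    fix K :: "'a set" and e :: real
    assume K: "compact K" and e: "e > 0"
    have A: "\<forall>\<^sub>F z in nhds a \<times>\<^sub>F nhds b. \<forall>x\<in>K. cmod (pairing (fst z) x - pairing a x) < e / 2"
      using filterlim_fst[of "nhds a" "nhds b"] K half_gt_zero[OF e] unfolding tendsto_dual_group_iff by blast
    have B: "\<forall>\<^sub>F z in nhds a \<times>\<^sub>F nhds b. \<forall>x\<in>K. cmod (pairing (snd z) x - pairing b x) < e / 2"
      using filterlim_snd[of "nhds b" "nhds a"] K half_gt_zero[OF e] unfolding tendsto_dual_group_iff by blast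
    show "\<forall>\<^sub>F z in nhds a \<times>\<^sub>F nhds b.
        \<forall>x\<in>K. cmod (pairing (fst z + snd z) x - pairing (a + b) x) < e"
      using A B
    proof eventually_elim
      case (elim z)
      show ?case
      proof
        fix x assume x: "x \<in> K"
        have "pairing (fst z + snd z) x - pairing (a + b) x =
            (pairing (fst z) x - pairing a x) * pairing (snd z) x +
            pairing a x * (pairing (snd z) x - pairing b x)"
          by (simp add: plus_dual_group.rep_eq algebra_simps)
        also have "cmod \<dots> \<le> cmod (pairing (fst z) x - pairing a x) +
            cmod (pairing (snd z) x - pairing b x)"
          by (rule order_trans[OF norm_triangle_ineq]) (simp add: norm_mult)
        also have "\<dots> < e"
          using bspec[OF elim(1) x] bspec[OF elim(2) x] by linarith
        finally show "cmod (pairing (fst z + snd z) x - pairing (a + b) x) < e" .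
      qed
    qed
  qed
next
  fix a :: "'a dual_group"
  have eq: "cmod (cnj u - cnj v) = cmod (u - v)" for u v
    unfolding complex_cnj_diff[symmetric] by (rule complex_mod_cnj)
  have "((\<lambda>b. b) \<longlongrightarrow> a) (nhds a)" by (rule filterlim_ident)
  then show "(uminus \<longlongrightarrow> - a) (nhds a)"
    unfolding tendsto_dual_group_iff by (simp add: uminus_dual_group.rep_eq eq)
qed

section \<open>Haar measure and the Fourier transform\<close>

text \<open>A Haar measure: a nonzero translation invariant Radon measure on the Borel sets.\<close>

definition haar_measure :: "'a::{topological_ab_group_add, t2_space} measure \<Rightarrow> bool" where
  "haar_measure M \<longleftrightarrow>
     sets M = sets borel \<and>
     (\<forall>K. compact K \<longrightarrow> emeasure M K < \<infinity>) \<and>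
     (\<forall>A\<in>sets borel. emeasure M A = (INF U\<in>{U. open U \<and> A \<subseteq> U}. emeasure M U)) \<and>
     (\<forall>U. open U \<longrightarrow> emeasure M U = (SUP K\<in>{K. compact K \<and> K \<subseteq> U}. emeasure M K)) \<and>
     (\<forall>x. \<forall>A\<in>sets borel. emeasure M ((+) x ` A) = emeasure M A) \<and>
     emeasure M UNIV \<noteq> 0"

text \<open>Square integrable functions, not identified up to null sets.\<close>

definition L2 :: "'a measure \<Rightarrow> ('a \<Rightarrow> complex) \<Rightarrow> bool" where
  "L2 M f \<longleftrightarrow> f \<in> borel_measurable M \<and> integrable M (\<lambda>x. (cmod (f x))\<^sup>2)"

definition fourier ::
  "'a::topological_ab_group_add measure \<Rightarrow> ('a \<Rightarrow> complex) \<Rightarrow> 'a dual_group \<Rightarrow> complex" where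
  "fourier \<mu> f = (\<lambda>c. \<integral>x. f x * cnj (pairing c x) \<partial>\<mu>)"

definition inv_fourier ::
  "'a::topological_ab_group_add dual_group measure \<Rightarrow> ('a dual_group \<Rightarrow> complex) \<Rightarrow> 'a \<Rightarrow> complex"
  where "inv_fourier \<nu> h = (\<lambda>x. \<integral>c. h c * pairing c x \<partial>\<nu>)"

text \<open>The normalisation of the two Haar measures: the Fourier inversion formula holds, and
  Plancherel's theorem holds, i.e. the Fourier transform is an isometry from the integrable and
  square integrable functions onto a dense subspace of the square integrable functions on the dual
  group. Given \<open>\<mu>\<close>, exactly one of the positive multiples of a Haar measure on
  the dual group has this property.\<close>

definition fourier_normalized ::
  "'a::{topological_ab_group_add, t2_space} measure \<Rightarrow> 'a dual_group measure \<Rightarrow> bool" where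
  "fourier_normalized \<mu> \<nu> \<longleftrightarrow>
     (\<forall>f. integrable \<mu> f \<and> integrable \<nu> (fourier \<mu> f) \<longrightarrow>
        (AE x in \<mu>. f x = inv_fourier \<nu> (fourier \<mu> f) x)) \<and>
     (\<forall>f. integrable \<mu> f \<and> L2 \<mu> f \<longrightarrow> L2 \<nu> (fourier \<mu> f) \<and>
        (\<integral>c. (cmod (fourier \<mu> f c))\<^sup>2 \<partial>\<nu>) = (\<integral>x. (cmod (f x))\<^sup>2 \<partial>\<mu>)) \<and>
     (\<forall>h. L2 \<nu> h \<longrightarrow> (\<forall>e>0. \<exists>f. integrable \<mu> f \<and> L2 \<mu> f \<and>
        (\<integral>c. (cmod (fourier \<mu> f c - h c))\<^sup>2 \<partial>\<nu>) < e))"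

text \<open>Elements of the harmonic Hilbert space are square integrable but need not be integrable, so
  their Fourier transform is the extension by continuity of \<^const>\<open>fourier\<close> to square integrable
  functions. It is determined up to null sets, and a representative is chosen.\<close>

definition is_L2_fourier ::
  "'a::topological_ab_group_add measure \<Rightarrow> 'a dual_group measure \<Rightarrow>
   ('a \<Rightarrow> complex) \<Rightarrow> ('a dual_group \<Rightarrow> complex) \<Rightarrow> bool" where
  "is_L2_fourier \<mu> \<nu> f h \<longleftrightarrow> L2 \<mu> f \<and> L2 \<nu> h \<and>
     (\<exists>F. (\<forall>n. integrable \<mu> (F n) \<and> L2 \<mu> (F n)) \<and>
        (\<lambda>n::nat. \<integral>x. (cmod (F n x - f x))\<^sup>2 \<partial>\<mu>) \<longlonglongrightarrow> 0 \<and>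
        (\<lambda>n. \<integral>c. (cmod (fourier \<mu> (F n) c - h c))\<^sup>2 \<partial>\<nu>) \<longlonglongrightarrow> 0)"

definition L2_fourier ::
  "'a::topological_ab_group_add measure \<Rightarrow> 'a dual_group measure \<Rightarrow>
   ('a \<Rightarrow> complex) \<Rightarrow> 'a dual_group \<Rightarrow> complex" where
  "L2_fourier \<mu> \<nu> f = (SOME h. is_L2_fourier \<mu> \<nu> f h)"

section \<open>Weights and harmonic Hilbert spaces\<close>

definition submultiplicative_weight :: "('b::{topological_space, plus} \<Rightarrow> real) \<Rightarrow> bool" where
  "submultiplicative_weight w \<longleftrightarrow>
     continuous_on UNIV w \<and> (\<forall>c. w c > 0) \<and> (\<forall>c d. w (c + d) \<le> w c * w d)"

text \<open>The constant sum \<open>\<Sum>i<Suc n. c\<close> is the multiple \<open>(n + 1) c\<close> in the group.\<close>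

definition beurling_domar :: "('b::ab_group_add \<Rightarrow> real) \<Rightarrow> bool" where
  "beurling_domar w \<longleftrightarrow>
     (\<forall>c. summable (\<lambda>n. ln (w (\<Sum>i<Suc n. c)) / (real (Suc n))\<^sup>2))"

definition L2_weighted :: "'b measure \<Rightarrow> ('b \<Rightarrow> real) \<Rightarrow> ('b \<Rightarrow> complex) set" where
  "L2_weighted \<nu> w = {h. h \<in> borel_measurable \<nu> \<and> L2 \<nu> (\<lambda>c. h c * complex_of_real (w c))}"

definition harmonic_space ::
  "'a::topological_ab_group_add dual_group measure \<Rightarrow> ('a dual_group \<Rightarrow> real) \<Rightarrow>
   ('a \<Rightarrow> complex) set" where
  "harmonic_space \<nu> w = inv_fourier \<nu> ` L2_weighted \<nu> w"

definition harmonic_inner ::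
  "'a::topological_ab_group_add measure \<Rightarrow> 'a dual_group measure \<Rightarrow> ('a dual_group \<Rightarrow> real) \<Rightarrow>
   ('a \<Rightarrow> complex) \<Rightarrow> ('a \<Rightarrow> complex) \<Rightarrow> complex" where
  "harmonic_inner \<mu> \<nu> w f g =
     (\<integral>c. L2_fourier \<mu> \<nu> f c * cnj (L2_fourier \<mu> \<nu> g c) * complex_of_real ((w c)\<^sup>2) \<partial>\<nu>)"

definition translate :: "'a::ab_group_add \<Rightarrow> ('a \<Rightarrow> complex) \<Rightarrow> 'a \<Rightarrow> complex" where
  "translate x f = (\<lambda>y. f (y - x))"

section \<open>Reproducing kernel Hilbert spaces\<close>

definition ip_dist :: "(('a \<Rightarrow> complex) \<Rightarrow> ('a \<Rightarrow> complex) \<Rightarrow> complex) \<Rightarrow>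
    ('a \<Rightarrow> complex) \<Rightarrow> ('a \<Rightarrow> complex) \<Rightarrow> real" where
  "ip_dist ip f g = sqrt (Re (ip (\<lambda>x. f x - g x) (\<lambda>x. f x - g x)))"

definition hilbert_function_space ::
  "('a \<Rightarrow> complex) set \<Rightarrow> (('a \<Rightarrow> complex) \<Rightarrow> ('a \<Rightarrow> complex) \<Rightarrow> complex) \<Rightarrow> bool" where
  "hilbert_function_space H ip \<longleftrightarrow>
     (\<lambda>_. 0) \<in> H \<and>
     (\<forall>f\<in>H. \<forall>g\<in>H. (\<lambda>x. f x + g x) \<in> H) \<and>
     (\<forall>a. \<forall>f\<in>H. (\<lambda>x. a * f x) \<in> H) \<and>
     (\<forall>f\<in>H. \<forall>g\<in>H. \<forall>h\<in>H. ip (\<lambda>x. f x + g x) h = ip f h + ip g h) \<and>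
     (\<forall>a. \<forall>f\<in>H. \<forall>g\<in>H. ip (\<lambda>x. a * f x) g = a * ip f g) \<and>
     (\<forall>f\<in>H. \<forall>g\<in>H. ip g f = cnj (ip f g)) \<and>
     (\<forall>f\<in>H. 0 \<le> Re (ip f f) \<and> (ip f f = 0 \<longrightarrow> f = (\<lambda>_. 0))) \<and>
     (\<forall>F. (\<forall>n::nat. F n \<in> H) \<and>
        (\<forall>e>0. \<exists>N. \<forall>m\<ge>N. \<forall>n\<ge>N. ip_dist ip (F m) (F n) < e) \<longrightarrow>
        (\<exists>f\<in>H. (\<lambda>n. ip_dist ip (F n) f) \<longlonglongrightarrow> 0))"

definition RKHS :: "('a::topological_space \<Rightarrow> complex) set \<Rightarrow>
    (('a \<Rightarrow> complex) \<Rightarrow> ('a \<Rightarrow> complex) \<Rightarrow> complex) \<Rightarrow> bool" where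
  "RKHS H ip \<longleftrightarrow>
     hilbert_function_space H ip \<and>
     (\<forall>f\<in>H. continuous_on UNIV f) \<and>
     (\<forall>x. \<forall>f\<in>H. \<forall>e>0. \<exists>d>0. \<forall>g\<in>H. ip_dist ip g f < d \<longrightarrow> cmod (g x - f x) < e)"

definition reproducing_kernel :: "('a \<Rightarrow> complex) set \<Rightarrow>
    (('a \<Rightarrow> complex) \<Rightarrow> ('a \<Rightarrow> complex) \<Rightarrow> complex) \<Rightarrow> ('a \<Rightarrow> 'a \<Rightarrow> complex) \<Rightarrow> bool" where
  "reproducing_kernel H ip k \<longleftrightarrow>
     (\<forall>x. k x \<in> H \<and> (\<forall>f\<in>H. f x = ip f (k x)) \<and>
        (\<forall>g\<in>H. (\<forall>f\<in>H. f x = ip f g) \<longrightarrow> g = k x))"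

end

theory Submission
  imports Defs
begin

text \<open>
  Write \<open>f \<in> \<H>\<^sub>w\<close> as the inverse Fourier integral of \<open>h\<close> with \<open>h w\<close> square integrable. If the
  Fourier transform of \<open>f\<close> is \<open>h\<close>, then \<open>\<langle>f, g\<rangle>\<^sub>w\<close> is the \<open>L\<^sup>2\<close> inner product of \<open>h w\<close> and
  \<open>k w\<close>, where \<open>k\<close> belongs to \<open>g\<close>. So \<open>\<H>\<^sub>w\<close> is a copy of \<open>L\<^sup>2\<close> and complete
  (\<open>L2_complete\<close>). The function \<open>y \<mapsto> \<phi> (y - x)\<close> belongs to \<open>w\<^sup>-\<^sup>2\<close> times the conjugate of
  evaluation at \<open>x\<close>, and pairing it with \<open>f\<close> cancels the weights and leaves
  \<open>\<integral> h(c) c(x) dc = f x\<close> (\<open>reproducing_property\<close>). Its norm is that of \<open>w\<^sup>-\<^sup>1\<close> in \<open>L\<^sup>2\<close>, which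
  bounds the point evaluation.

  The Beurling--Domar condition forces \<open>w \<ge> 1\<close> (\<open>beurling_domar_weight_ge_1\<close>), so \<open>h\<close> is
  square integrable; since \<open>w\<^sup>-\<^sup>1\<close> is square integrable, \<open>h = (h w) w\<^sup>-\<^sup>1\<close> is also integrable.

  The main work is the claim that the extended Fourier transform of the inverse Fourier integral
  \<open>p\<close> of such an \<open>h\<close> is \<open>h\<close> (\<open>is_L2_fourier_inv_fourier\<close>). By density there are \<open>F\<^sub>n\<close>, integrable and
  square integrable, whose transforms converge to \<open>h\<close>; to show is that \<open>F\<^sub>n\<close> converges to \<open>p\<close> in
  square mean. Testing \<open>F\<^sub>n - p\<close> against functions with compact support, Parseval's formula and
  Fubini's theorem bound its square integral over every compact set by the squared distance of the
  transform of \<open>F\<^sub>n\<close> to \<open>h\<close> (\<open>inv_fourier_close\<close>). The group is not assumed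
  \<open>\<sigma>\<close>-compact or second countable, and this affects two steps. Fubini's theorem needs the
  pairing to be measurable for the product of the Borel \<open>\<sigma>\<close>-algebras; this holds on compact
  rectangles (\<open>pairing_measurable_compact_rectangle\<close>), and they suffice because square
  integrability of \<open>w\<^sup>-\<^sup>1\<close> makes the dual group a countable union of sets of finite measure,
  hence, up to a null set, of compact sets. Bounds on compact sets become a global bound because
  \<open>F\<^sub>n\<close> is square integrable and \<open>p\<close> is continuous
  (\<open>L2_diff_continuous_of_compact_bound\<close>).
\<close>

section \<open>Square integrable functions\<close>

abbreviation sqnorm :: "'a measure \<Rightarrow> ('a \<Rightarrow> complex) \<Rightarrow> real" where
  "sqnorm M f \<equiv> (\<integral>x. (cmod (f x))\<^sup>2 \<partial>M)"

lemma cmod_add_sq_le: "(cmod (a + b))\<^sup>2 \<le> 2 * (cmod a)\<^sup>2 + 2 * (cmod b)\<^sup>2"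
proof -
  have "(cmod (a + b))\<^sup>2 \<le> (cmod a + cmod b)\<^sup>2"
    by (intro power_mono norm_triangle_ineq norm_ge_zero)
  also have "\<dots> \<le> 2 * (cmod a)\<^sup>2 + 2 * (cmod b)\<^sup>2"
    using sum_squares_bound[of "cmod a" "cmod b"] by (simp add: power2_sum)
  finally show ?thesis .
qed

lemma L2_measurable [measurable_dest]: "L2 M f \<Longrightarrow> f \<in> borel_measurable M"
  by (simp add: L2_def)

lemma L2_integrable: "L2 M f \<Longrightarrow> integrable M (\<lambda>x. (cmod (f x))\<^sup>2)"
  by (simp add: L2_def)

lemma L2_bound:
  assumes "f \<in> borel_measurable M" "L2 M g" "AE x in M. cmod (f x) \<le> cmod (g x)"
  shows "L2 M f"
  unfolding L2_def
proof
  show "integrable M (\<lambda>x. (cmod (f x))\<^sup>2)"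
    using assms(1) assms(3)
    by (intro Bochner_Integration.integrable_bound[OF L2_integrable[OF assms(2)]])
       (auto intro: power_mono elim!: eventually_mono)
qed fact

lemma L2_add:
  assumes "L2 M f" "L2 M g"
  shows "L2 M (\<lambda>x. f x + g x)"
  unfolding L2_def
proof
  have [measurable]: "f \<in> borel_measurable M" "g \<in> borel_measurable M"
    using assms by (auto dest: L2_measurable)
  show "(\<lambda>x. f x + g x) \<in> borel_measurable M" by measurable
  show "integrable M (\<lambda>x. (cmod (f x + g x))\<^sup>2)"
    by (rule Bochner_Integration.integrable_bound
          [of _ "\<lambda>x. 2 * (cmod (f x))\<^sup>2 + 2 * (cmod (g x))\<^sup>2"])
       (use assms cmod_add_sq_le in \<open>auto simp: L2_def\<close>)
qed

lemma L2_cmult: "L2 M f \<Longrightarrow> L2 M (\<lambda>x. a * f x)"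
  by (auto simp: L2_def norm_mult power_mult_distrib)

lemma L2_diff: "L2 M f \<Longrightarrow> L2 M g \<Longrightarrow> L2 M (\<lambda>x. f x - g x)"
  using L2_add[of M f "\<lambda>x. (-1) * g x"] L2_cmult[of M g "-1"] by simp

lemma sqnorm_add_le:
  assumes "L2 M f" "L2 M g"
  shows "sqnorm M (\<lambda>x. f x + g x) \<le> 2 * sqnorm M f + 2 * sqnorm M g"
proof -
  have "sqnorm M (\<lambda>x. f x + g x) \<le> (\<integral>x. 2 * (cmod (f x))\<^sup>2 + 2 * (cmod (g x))\<^sup>2 \<partial>M)"
    by (rule integral_mono)
       (use assms L2_add[OF assms] cmod_add_sq_le in \<open>auto simp: L2_def\<close>)
  also have "\<dots> = 2 * sqnorm M f + 2 * sqnorm M g"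
    using assms by (subst Bochner_Integration.integral_add) (auto simp: L2_def)
  finally show ?thesis .
qed

lemma sqnorm_triangle:
  assumes "L2 M f" "L2 M g" "L2 M h"
  shows "sqnorm M (\<lambda>x. f x - h x) \<le>
    2 * sqnorm M (\<lambda>x. f x - g x) + 2 * sqnorm M (\<lambda>x. g x - h x)"
  using sqnorm_add_le[OF L2_diff[OF assms(1,2)] L2_diff[OF assms(2,3)]] by simp

lemma sqnorm_commute: "sqnorm M (\<lambda>x. f x - g x) = sqnorm M (\<lambda>x. g x - f x)"
  by (simp add: norm_minus_commute)

lemma sqnorm_eq_0_AE:
  assumes "L2 M f" "sqnorm M f = 0"
  shows "AE x in M. f x = 0"
  using assms integral_nonneg_eq_0_iff_AE[of M "\<lambda>x. (cmod (f x))\<^sup>2"]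
  by (simp add: L2_def)

lemma L2_mult_integrable:
  assumes "L2 M f" "L2 M g"
  shows "integrable M (\<lambda>x. f x * g x)"
proof -
  have [measurable]: "f \<in> borel_measurable M" "g \<in> borel_measurable M"
    using assms by (auto dest: L2_measurable)
  show ?thesis
  proof (rule Bochner_Integration.integrable_bound)
    show "integrable M (\<lambda>x. (cmod (f x))\<^sup>2 + (cmod (g x))\<^sup>2)"
      using assms by (auto simp: L2_def)
    have "cmod (f x) * cmod (g x) \<le> (cmod (f x))\<^sup>2 + (cmod (g x))\<^sup>2" for x
      using sum_squares_bound[of "cmod (f x)" "cmod (g x)"]
        mult_nonneg_nonneg[of "cmod (f x)" "cmod (g x)"] by (simp del: mult_nonneg_nonneg)
    then show "AE x in M. norm (f x * g x) \<le> norm ((cmod (f x))\<^sup>2 + (cmod (g x))\<^sup>2)"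
      by (intro AE_I2) (simp add: norm_mult)
  qed measurable
qed

lemma L2_cnj:
  assumes "L2 M f"
  shows "L2 M (\<lambda>x. cnj (f x))"
proof -
  have "(\<lambda>x. cnj (f x)) \<in> borel_measurable M"
    by (rule borel_measurable_continuous_on[OF _ L2_measurable[OF assms]])
       (rule continuous_on_cnj[OF continuous_on_id])
  then show ?thesis using assms by (simp add: L2_def)
qed

lemma L2_cnj_integrable: "L2 M f \<Longrightarrow> L2 M g \<Longrightarrow> integrable M (\<lambda>x. f x * cnj (g x))"
  by (intro L2_mult_integrable L2_cnj)

text \<open>The pointwise bound \<open>2 |a b| \<le> |a|\<^sup>2 + |b|\<^sup>2\<close>, integrated. Being linear in the squared norms,
  it allows a squared norm on the right to be absorbed on the left.\<close>

lemma Re_inner_le: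
  assumes "L2 M f" "L2 M g"
  shows "2 * Re (\<integral>x. f x * cnj (g x) \<partial>M) \<le> sqnorm M f + sqnorm M g"
proof -
  have "2 * Re (\<integral>x. f x * cnj (g x) \<partial>M) = (\<integral>x. 2 * Re (f x * cnj (g x)) \<partial>M)"
    using integral_Re[OF L2_cnj_integrable[OF assms]] by (simp del: times_complex.sel)
  also have "\<dots> \<le> (\<integral>x. (cmod (f x))\<^sup>2 + (cmod (g x))\<^sup>2 \<partial>M)"
  proof (rule integral_mono)
    show "integrable M (\<lambda>x. 2 * Re (f x * cnj (g x)))"
      by (rule integrable_mult_right[OF integrable_Re[OF L2_cnj_integrable[OF assms]]])
    show "integrable M (\<lambda>x. (cmod (f x))\<^sup>2 + (cmod (g x))\<^sup>2)"
      using assms by (auto simp: L2_def)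
    fix x
    have "Re (f x * cnj (g x)) \<le> cmod (f x) * cmod (g x)"
      using complex_Re_le_cmod[of "f x * cnj (g x)"] by (simp add: norm_mult)
    then show "2 * Re (f x * cnj (g x)) \<le> (cmod (f x))\<^sup>2 + (cmod (g x))\<^sup>2"
      using sum_squares_bound[of "cmod (f x)" "cmod (g x)"] by linarith
  qed
  also have "\<dots> = sqnorm M f + sqnorm M g"
    using assms by (subst Bochner_Integration.integral_add) (auto simp: L2_def)
  finally show ?thesis .
qed

lemma cauchy_schwarz_L2:
  assumes "L2 M f" "L2 M g"
  shows "(cmod (\<integral>x. f x * g x \<partial>M))\<^sup>2 \<le> sqnorm M f * sqnorm M g"
proof -
  have [measurable]: "f \<in> borel_measurable M" "g \<in> borel_measurable M"
    using assms by (auto dest: L2_measurable)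
  have i: "integrable M (\<lambda>x. cmod (f x) * cmod (g x))"
    using L2_mult_integrable[OF assms] by (auto dest: integrable_norm simp: norm_mult)
  have "cmod (\<integral>x. f x * g x \<partial>M) \<le> (\<integral>x. cmod (f x) * cmod (g x) \<partial>M)"
    using integral_norm_bound[of M "\<lambda>x. f x * g x"] by (simp add: norm_mult)
  then have le: "(cmod (\<integral>x. f x * g x \<partial>M))\<^sup>2 \<le> (\<integral>x. cmod (f x) * cmod (g x) \<partial>M)\<^sup>2"
    by (intro power_mono) auto
  have "ennreal ((\<integral>x. cmod (f x) * cmod (g x) \<partial>M)\<^sup>2) = (\<integral>\<^sup>+x. ennreal (cmod (f x)) * ennreal (cmod (g x)) \<partial>M)\<^sup>2"
    using i by (subst nn_integral_eq_integral[symmetric] ennreal_power[symmetric]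
      ennreal_mult[symmetric]; simp)+
  also have "\<dots> \<le> (\<integral>\<^sup>+x. (ennreal (cmod (f x)))\<^sup>2 \<partial>M) * (\<integral>\<^sup>+x. (ennreal (cmod (g x)))\<^sup>2 \<partial>M)"
    by (rule Cauchy_Schwarz_nn_integral) auto
  also have "\<dots> = ennreal (sqnorm M f * sqnorm M g)"
    using assms by (simp add: ennreal_power L2_def nn_integral_eq_integral ennreal_mult)
  finally have "(\<integral>x. cmod (f x) * cmod (g x) \<partial>M)\<^sup>2 \<le> sqnorm M f * sqnorm M g"
    by (subst (asm) ennreal_le_iff) auto
  with le show ?thesis by (rule order_trans)
qed

lemma L2_level_set_finite:
  assumes f: "L2 M f"
  shows "emeasure M {x \<in> space M. 1 / real (Suc n) < cmod (f x)} < \<infinity>"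
proof -
  note [measurable] = L2_measurable[OF f]
  have "{x \<in> space M. 1 / real (Suc n) < cmod (f x)}
      \<subseteq> {x \<in> space M. 1 \<le> ennreal ((real (Suc n))\<^sup>2) * ennreal ((cmod (f x))\<^sup>2)}"
  proof safe
    fix x assume "1 / real (Suc n) < cmod (f x)"
    then have "1 \<le> real (Suc n) * cmod (f x)" by (simp add: field_simps)
    then have "1 \<le> (real (Suc n) * cmod (f x))\<^sup>2" by (rule one_le_power)
    then show "1 \<le> ennreal ((real (Suc n))\<^sup>2) * ennreal ((cmod (f x))\<^sup>2)"
      by (simp add: power_mult_distrib ennreal_mult[symmetric])
  qed
  then have "emeasure M {x \<in> space M. 1 / real (Suc n) < cmod (f x)}
      \<le> emeasure M {x \<in> space M. 1 \<le> ennreal ((real (Suc n))\<^sup>2) * ennreal ((cmod (f x))\<^sup>2)}"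
    by (rule emeasure_mono) measurable
  also have "\<dots> \<le> ennreal ((real (Suc n))\<^sup>2) *
      (\<integral>\<^sup>+x. ennreal ((cmod (f x))\<^sup>2) * indicator (space M) x \<partial>M)"
    by (rule order_trans[OF nn_integral_Markov_inequality]) auto
  also have "(\<integral>\<^sup>+x. ennreal ((cmod (f x))\<^sup>2) * indicator (space M) x \<partial>M) = ennreal (sqnorm M f)"
    using L2_integrable[OF f]
    by (simp add: nn_integral_eq_integral[symmetric] nn_integral_cong[of M "\<lambda>x. _ * indicator (space M) x"])
  also have "ennreal ((real (Suc n))\<^sup>2) * \<dots> < \<infinity>"
    by (simp add: ennreal_mult_less_top)
  finally show ?thesis .
qed

text \<open>Riesz--Fischer. Along a subsequence with \<open>\<parallel>g\<^sub>k\<^sub>+\<^sub>1 - g\<^sub>k\<parallel>\<^sup>2 < 1/8\<^sup>k\<close> the series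
  \<open>\<Sum> 2\<^sup>k |g\<^sub>k\<^sub>+\<^sub>1 - g\<^sub>k|\<^sup>2\<close> has a finite integral, so it converges almost everywhere, and there
  \<open>|g\<^sub>k\<^sub>+\<^sub>1 - g\<^sub>k|\<close> decays geometrically and \<open>g\<^sub>k\<close> converges. Fatou's lemma turns the pointwise
  limit into a limit in square mean.\<close>

lemma L2_complete:
  fixes f :: "nat \<Rightarrow> 'a \<Rightarrow> complex"
  assumes f: "\<And>n. L2 M (f n)"
    and cauchy: "\<And>e. e > 0 \<Longrightarrow> \<exists>N. \<forall>m\<ge>N. \<forall>n\<ge>N. sqnorm M (\<lambda>x. f m x - f n x) < e"
  obtains g where "L2 M g" "(\<lambda>n. sqnorm M (\<lambda>x. f n x - g x)) \<longlonglongrightarrow> 0"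
proof -
  have [measurable]: "f n \<in> borel_measurable M" for n
    using f by (auto dest: L2_measurable)
  have "\<exists>N. \<forall>m\<ge>N. \<forall>n\<ge>N. sqnorm M (\<lambda>x. f m x - f n x) < (1/8)^k" for k :: nat
    by (rule cauchy) simp
  then obtain N where N: "\<And>k m n. m \<ge> N k \<Longrightarrow> n \<ge> N k \<Longrightarrow>
      sqnorm M (\<lambda>x. f m x - f n x) < (1/8)^k" by metis
  \<comment> \<open>adding \<open>k\<close> makes \<open>r k\<close> tend to infinity; the sum makes it exceed the thresholds\<close>
  define r where "r k = k + (\<Sum>i\<le>k. N i)" for k
  have rN: "r k \<ge> N k" and r_Suc: "r (Suc k) \<ge> N k" and r_ge: "r k \<ge> k" for k
    using member_le_sum[of k "{..k}" N] member_le_sum[of k "{..Suc k}" N] by (auto simp: r_def)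
  define d where "d k x = cmod (f (r (Suc k)) x - f (r k) x)" for k x
  have d_meas [measurable]: "d k \<in> borel_measurable M" for k
    unfolding d_def by measurable
  have nn_sq: "(\<integral>\<^sup>+x. ennreal ((cmod (f m x - f n x))\<^sup>2) \<partial>M) = ennreal (sqnorm M (\<lambda>x. f m x - f n x))"
    for m n
    using L2_diff[OF f f] by (intro nn_integral_eq_integral) (auto simp: L2_def)
  have "(\<integral>\<^sup>+x. (\<Sum>k. ennreal (2^k * (d k x)\<^sup>2)) \<partial>M) = (\<Sum>k. \<integral>\<^sup>+x. ennreal (2^k * (d k x)\<^sup>2) \<partial>M)"
    by (rule nn_integral_suminf) measurable
  also have "\<dots> \<le> (\<Sum>k. ennreal ((1/4)^k))"
  proof (rule suminf_le)
    fix k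
    have "(\<integral>\<^sup>+x. ennreal (2^k * (d k x)\<^sup>2) \<partial>M) = ennreal (2^k) * (\<integral>\<^sup>+x. ennreal ((d k x)\<^sup>2) \<partial>M)"
      by (subst nn_integral_cmult[symmetric]) (auto simp: ennreal_mult)
    also have "\<dots> = ennreal (2^k * sqnorm M (\<lambda>x. f (r (Suc k)) x - f (r k) x))"
      unfolding d_def nn_sq by (simp add: ennreal_mult)
    also have "\<dots> \<le> ennreal (2^k * (1/8)^k)"
      using N[OF r_Suc rN, of k] by (intro ennreal_leI mult_left_mono) auto
    also have "(2::real)^k * (1/8)^k = (1/4)^k"
      by (simp add: power_mult_distrib[symmetric])
    finally show "(\<integral>\<^sup>+x. ennreal (2^k * (d k x)\<^sup>2) \<partial>M) \<le> ennreal ((1/4)^k)" .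
  qed auto
  also have "\<dots> < \<infinity>"
    by (subst suminf_ennreal2) (auto intro!: summable_geometric)
  finally have "AE x in M. (\<Sum>k. ennreal (2^k * (d k x)\<^sup>2)) \<noteq> \<infinity>"
    by (intro nn_integral_noteq_infinite) auto
  then have conv: "AE x in M. convergent (\<lambda>k. f (r k) x)"
  proof eventually_elim
    case (elim x)
    then have "summable (\<lambda>k. 2^k * (d k x)\<^sup>2)"
      by (intro summable_suminf_not_top) auto
    then have "(\<lambda>k. 2^k * (d k x)\<^sup>2) \<longlonglongrightarrow> 0" by (rule summable_LIMSEQ_zero)
    then have "\<forall>\<^sub>F k in sequentially. 2^k * (d k x)\<^sup>2 < 1"
      by (rule order_tendstoD) simp
    then have "\<forall>\<^sub>F k in sequentially. norm (f (r (Suc k)) x - f (r k) x) \<le> (sqrt (1/2))^k"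
    proof eventually_elim
      case (elim k)
      have "(d k x)\<^sup>2 \<le> (1/2)^k" using elim by (simp add: field_simps)
      then have "sqrt ((d k x)\<^sup>2) \<le> sqrt ((1/2)^k)" by (rule real_sqrt_le_mono)
      then show ?case by (simp add: d_def real_sqrt_power)
    qed
    then have "summable (\<lambda>k. f (r (Suc k)) x - f (r k) x)"
      by (rule summable_comparison_test_ev) (auto intro!: summable_geometric)
    then have "convergent (\<lambda>n. \<Sum>k<n. f (r (Suc k)) x - f (r k) x)"
      by (simp add: summable_iff_convergent)
    then have "convergent (\<lambda>n. (f (r n) x - f (r 0) x) + f (r 0) x)"
      by (intro convergent_add convergent_const)
         (simp add: sum_lessThan_telescope[of "\<lambda>k. f (r k) x"])
    then show ?case by simp
  qed
  define g where "g x = lim (\<lambda>k. f (r k) x)" for x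
  have [measurable]: "g \<in> borel_measurable M"
    unfolding g_def by (intro borel_measurable_lim_metric) measurable
  have fatou: "(\<integral>\<^sup>+x. ennreal ((cmod (f n x - g x))\<^sup>2) \<partial>M) \<le> ennreal e"
    if Ne: "\<forall>m\<ge>N'. \<forall>n\<ge>N'. sqnorm M (\<lambda>x. f m x - f n x) < e" and n: "n \<ge> N'" for n N' e
  proof -
    have "(\<integral>\<^sup>+x. ennreal ((cmod (f n x - g x))\<^sup>2) \<partial>M) \<le>
        (\<integral>\<^sup>+x. liminf (\<lambda>k. ennreal ((cmod (f n x - f (r k) x))\<^sup>2)) \<partial>M)"
    proof (rule nn_integral_mono_AE, use conv in eventually_elim)
      case (elim x)
      then have "(\<lambda>k. f (r k) x) \<longlonglongrightarrow> g x" by (simp add: g_def convergent_LIMSEQ_iff)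
      then have "(\<lambda>k. ennreal ((cmod (f n x - f (r k) x))\<^sup>2)) \<longlonglongrightarrow> ennreal ((cmod (f n x - g x))\<^sup>2)"
        by (intro tendsto_intros)
      from lim_imp_Liminf[OF _ this] show ?case by simp
    qed
    also have "\<dots> \<le> liminf (\<lambda>k. \<integral>\<^sup>+x. ennreal ((cmod (f n x - f (r k) x))\<^sup>2) \<partial>M)"
      by (rule nn_integral_liminf) measurable
    also have "\<dots> \<le> liminf (\<lambda>k::nat. ennreal e)"
    proof (rule Liminf_mono)
      have "(\<integral>\<^sup>+x. ennreal ((cmod (f n x - f (r k) x))\<^sup>2) \<partial>M) \<le> ennreal e" if "k \<ge> N'" for k
        unfolding nn_sq using Ne n order_trans[OF that r_ge] by (intro ennreal_leI less_imp_le) auto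
      then show "\<forall>\<^sub>F k in sequentially. (\<integral>\<^sup>+x. ennreal ((cmod (f n x - f (r k) x))\<^sup>2) \<partial>M) \<le> ennreal e"
        by (auto simp: eventually_sequentially)
    qed
    also have "\<dots> = ennreal e" by (rule Liminf_const) simp
    finally show ?thesis .
  qed
  have diff: "L2 M (\<lambda>x. f n x - g x) \<and> sqnorm M (\<lambda>x. f n x - g x) \<le> e"
    if "\<forall>m\<ge>N'. \<forall>n\<ge>N'. sqnorm M (\<lambda>x. f m x - f n x) < e" "n \<ge> N'" "e > 0" for n N' e
  proof
    show "L2 M (\<lambda>x. f n x - g x)" unfolding L2_def
      using le_less_trans[OF fatou[OF that(1,2)] ennreal_less_top]
      by (intro conjI integrableI_nonneg) auto
    then have "ennreal (sqnorm M (\<lambda>x. f n x - g x)) \<le> ennreal e"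
      using fatou[OF that(1,2)] by (subst nn_integral_eq_integral[symmetric]) (auto simp: L2_def)
    then show "sqnorm M (\<lambda>x. f n x - g x) \<le> e" using \<open>e > 0\<close> by simp
  qed
  show ?thesis
  proof
    obtain N1 where "\<forall>m\<ge>N1. \<forall>n\<ge>N1. sqnorm M (\<lambda>x. f m x - f n x) < 1" using cauchy[of 1] by auto
    from diff[OF this order_refl] have "L2 M (\<lambda>x. f N1 x - g x)" by simp
    from L2_diff[OF f[of N1] this] show "L2 M g" by simp
    show "(\<lambda>n. sqnorm M (\<lambda>x. f n x - g x)) \<longlonglongrightarrow> 0"
    proof (rule LIMSEQ_I)
      fix e :: real assume "e > 0"
      then obtain N' where "\<forall>m\<ge>N'. \<forall>n\<ge>N'. sqnorm M (\<lambda>x. f m x - f n x) < e/2"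
        using cauchy[of "e/2"] by auto
      from diff[OF this] \<open>e > 0\<close>
      have "sqnorm M (\<lambda>x. f n x - g x) \<le> e/2" if "n \<ge> N'" for n using that by auto
      then show "\<exists>no. \<forall>n\<ge>no. norm (sqnorm M (\<lambda>x. f n x - g x) - 0) < e"
        using \<open>e > 0\<close> by (intro exI[of _ N']) force
    qed
  qed
qed

section \<open>Exhaustion by compact sets\<close>

lemma haar_measureD:
  assumes "haar_measure M"
  shows haar_sets: "sets M = sets borel"
    and haar_compact_finite: "compact K \<Longrightarrow> emeasure M K < \<infinity>"
    and haar_emeasure_INF:
      "A \<in> sets borel \<Longrightarrow> emeasure M A = (INF U\<in>{U. open U \<and> A \<subseteq> U}. emeasure M U)"
    and haar_emeasure_SUP:
      "open U \<Longrightarrow> emeasure M U = (SUP K\<in>{K. compact K \<and> K \<subseteq> U}. emeasure M K)"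
proof -
  note * = assms[unfolded haar_measure_def]
  show "sets M = sets borel" using * by (rule conjunct1)
  show "compact K \<Longrightarrow> emeasure M K < \<infinity>"
    by (rule *[THEN conjunct2, THEN conjunct1, rule_format])
  show "A \<in> sets borel \<Longrightarrow> emeasure M A = (INF U\<in>{U. open U \<and> A \<subseteq> U}. emeasure M U)"
    by (rule *[THEN conjunct2, THEN conjunct2, THEN conjunct1, rule_format])
  show "open U \<Longrightarrow> emeasure M U = (SUP K\<in>{K. compact K \<and> K \<subseteq> U}. emeasure M K)"
    by (rule *[THEN conjunct2, THEN conjunct2, THEN conjunct2, THEN conjunct1, rule_format])
qed

lemma haar_space: "haar_measure M \<Longrightarrow> space M = UNIV"
  using sets_eq_imp_space_eq[OF haar_sets] by simp

lemma haar_measurable: "haar_measure M \<Longrightarrow> measurable M N = measurable borel N"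
  by (rule measurable_cong_sets[OF haar_sets refl])

lemma haar_compact: "haar_measure M \<Longrightarrow> compact K \<Longrightarrow> K \<in> sets M \<and> emeasure M K < \<infinity>"
  using haar_compact_finite by (simp add: haar_sets borel_closed compact_imp_closed)

lemma haar_outer_regular:
  assumes "haar_measure M" "A \<in> sets borel" "emeasure M A < \<infinity>"
  obtains U where "open U" "A \<subseteq> U" "emeasure M U < \<infinity>"
proof -
  have "(INF U\<in>{U. open U \<and> A \<subseteq> U}. emeasure M U) < \<infinity>"
    unfolding haar_emeasure_INF[OF assms(1,2), symmetric] by (rule assms(3))
  then show thesis using that unfolding INF_less_iff by blast
qed

lemma haar_inner_regular:
  fixes e :: real
  assumes M: "haar_measure M" and U: "open U" "emeasure M U < \<infinity>" and e: "e > 0"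
  obtains K where "compact K" "K \<subseteq> U" "emeasure M (U - K) < ennreal e"
proof -
  have "{K. compact K \<and> K \<subseteq> U} \<noteq> {}" by (auto intro: exI[of _ "{}"])
  from SUP_approx_ennreal[OF e this haar_emeasure_SUP[OF M U(1)]] less_imp_neq[OF U(2)]
  obtain K where K: "compact K" "K \<subseteq> U" "emeasure M U < emeasure M K + ennreal e" by auto
  note cpt = haar_compact[OF M K(1)]
  have UM: "U \<in> sets M" using U(1) by (simp add: haar_sets[OF M])
  have le: "emeasure M K \<le> emeasure M U" by (rule emeasure_mono[OF K(2) UM])
  have "emeasure M (U - K) = emeasure M U - emeasure M K"
    using cpt K(2) UM by (intro emeasure_Diff) auto
  also have "\<dots> < ennreal e"
    using K(3) cpt le by (subst minus_less_iff_ennreal) (auto simp: add.commute)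
  finally show ?thesis using that K by blast
qed

text \<open>Haar measures are inner regular only on open sets, and the group may be far from
  \<open>\<sigma>\<close>-compact, so a set that meets every compact set in a null set can have positive measure.
  This defect disappears on \<open>\<sigma>\<close>-finite sets: each of the countably many pieces lies in an
  open set of finite measure, which compact sets exhaust up to a null set.\<close>

lemma sigma_finite_compact_exhaustion:
  fixes M :: "'a::{topological_ab_group_add, t2_space} measure" and A :: "nat \<Rightarrow> 'a set"
  assumes M: "haar_measure M"
    and A: "\<And>n. A n \<in> sets borel" "\<And>n. emeasure M (A n) < \<infinity>"
  obtains D :: "nat \<Rightarrow> 'a set" where "\<And>n. compact (D n)" "incseq D"
    "(\<Union>n. A n) - (\<Union>n. D n) \<in> null_sets M"
proof -
  have "\<exists>U. open U \<and> A n \<subseteq> U \<and> emeasure M U < \<infinity>" for n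
    using haar_outer_regular[OF M A] by metis
  then obtain U where U: "\<And>n. open (U n)" "\<And>n. A n \<subseteq> U n" "\<And>n. emeasure M (U n) < \<infinity>"
    by metis
  have "\<exists>K. compact K \<and> K \<subseteq> U n \<and> emeasure M (U n - K) < ennreal (1 / Suc k)" for n k
    using haar_inner_regular[OF M U(1,3), of "1 / Suc k" n]
    by (metis zero_less_divide_1_iff of_nat_0_less_iff zero_less_Suc)
  then obtain K where K: "\<And>n k. compact (K n k)"
      "\<And>n k. emeasure M (U n - K n k) < ennreal (1 / Suc k)"
    by metis
  \<comment> \<open>finite unions, so that \<open>D j\<close> is compact and increasing\<close>
  define D where "D j = (\<Union>n\<le>j. \<Union>k\<le>j. K n k)" for j
  have compD: "compact (D j)" for j unfolding D_def by (intro compact_UN K finite_atMost)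
  have D_ex: "K n k \<subseteq> (\<Union>j. D j)" for n k
  proof -
    have "K n k \<subseteq> (\<Union>k\<le>max n k. K n k)" by (rule UN_upper) simp
    also have "\<dots> \<subseteq> D (max n k)"
      unfolding D_def by (rule UN_upper[of n _ "\<lambda>n'. \<Union>k\<le>max n k. K n' k"]) simp
    finally show ?thesis by (rule order_trans) (rule UN_upper, simp)
  qed
  have [measurable]: "A n \<in> sets M" "D n \<in> sets M" "U n \<in> sets M" "K n k \<in> sets M" for n k
    using A compD haar_compact[OF M] U(1) K(1) by (auto simp: haar_sets[OF M])
  have "A n - (\<Union>j. D j) \<in> null_sets M" for n
  proof (rule null_setsI)
    have "emeasure M (A n - (\<Union>j. D j)) \<le> ennreal (1 / Suc k)" for k
    proof -
      have "emeasure M (A n - (\<Union>j. D j)) \<le> emeasure M (U n - K n k)"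
        using U(2)[of n] D_ex[of n k] by (intro emeasure_mono) auto
      then show ?thesis using K(2)[of n k] by simp
    qed
    moreover have "(\<lambda>k. ennreal (1 / Suc k)) \<longlonglongrightarrow> ennreal 0"
      by (intro tendsto_ennrealI LIMSEQ_Suc lim_1_over_n)
    ultimately have "emeasure M (A n - (\<Union>j. D j)) \<le> ennreal 0"
      by (intro LIMSEQ_le_const) auto
    then show "emeasure M (A n - (\<Union>j. D j)) = 0" by simp
  qed measurable
  then have "(\<Union>n. A n - (\<Union>j. D j)) \<in> null_sets M" by (rule null_sets_UN)
  moreover have "(\<Union>n. A n - (\<Union>j. D j)) = (\<Union>n. A n) - (\<Union>n. D n)" by auto
  moreover have "incseq D" unfolding D_def by (intro incseq_SucI UN_mono) auto
  ultimately show thesis using that[of D] compD by simp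
qed

text \<open>Local bounds on square integrals become global ones. What is needed for this is that
  \<open>F - p\<close> vanishes outside a \<open>\<sigma>\<close>-finite set. For \<open>p\<close> this comes from continuity: a compact set \<open>K\<close>
  on which \<open>|p| > 1/n\<close> has measure at most \<open>n\<^sup>2 \<integral>\<^sub>K |p|\<^sup>2\<close>, which is bounded independently
  of \<open>K\<close>, so the open set \<open>{|p| > 1/n}\<close> has finite measure by inner regularity.\<close>

lemma L2_diff_continuous_of_compact_bound:
  fixes M :: "'a::{topological_ab_group_add, t2_space} measure" and p F :: "'a \<Rightarrow> complex"
  assumes M: "haar_measure M" and p: "continuous_on UNIV p" and F: "L2 M F"
    and bd: "\<And>K. compact K \<Longrightarrow> integrable M (\<lambda>x. indicator K x * (cmod (F x - p x))\<^sup>2) \<and>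
      (\<integral>x. indicator K x * (cmod (F x - p x))\<^sup>2 \<partial>M) \<le> B"
  shows "L2 M (\<lambda>x. F x - p x)" and "sqnorm M (\<lambda>x. F x - p x) \<le> B"
proof -
  note [simp] = haar_space[OF M]
  have [measurable]: "F \<in> borel_measurable M" "p \<in> borel_measurable M"
    using L2_measurable[OF F] borel_measurable_continuous_onI[OF p] haar_measurable[OF M] by auto
  have cpt: "K \<in> sets M" "emeasure M K < \<infinity>" if "compact K" for K
    using haar_compact[OF M that] by auto
  have B0: "0 \<le> B" using bd[OF compact_empty] by simp
  define P where "P n = {x. cmod (p x) > 1 / Suc n}" for n
  define Q where "Q n = {x. cmod (F x) > 1 / Suc n}" for n
  have P_open: "open (P n)" for n
    unfolding P_def by (intro open_Collect_less continuous_intros p)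
  have P_fin: "emeasure M (P n) < \<infinity>" for n
  proof -
    \<comment> \<open>from \<open>|p|\<^sup>2 \<le> 2 |F|\<^sup>2 + 2 |F - p|\<^sup>2\<close>\<close>
    define C where "C = (real (Suc n))\<^sup>2 * (2 * sqnorm M F + 2 * B)"
    have "emeasure M K \<le> ennreal C" if K: "compact K" "K \<subseteq> P n" for K
    proof -
      have le: "indicator K x \<le> (real (Suc n))\<^sup>2 *
          (2 * (cmod (F x))\<^sup>2 + 2 * (indicator K x * (cmod (F x - p x))\<^sup>2))" for x
      proof (cases "x \<in> K")
        case True
        then have "1 / Suc n < cmod (p x)" using K(2) by (auto simp: P_def)
        then have "1 \<le> real (Suc n) * cmod (p x)" by (simp add: field_simps)
        then have "1 \<le> (real (Suc n) * cmod (p x))\<^sup>2" by (rule one_le_power)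
        also have "\<dots> \<le> (real (Suc n))\<^sup>2 * (2 * (cmod (F x))\<^sup>2 + 2 * (cmod (F x - p x))\<^sup>2)"
          using cmod_add_sq_le[of "F x" "p x - F x"]
          unfolding power_mult_distrib by (intro mult_left_mono) (simp_all add: norm_minus_commute)
        finally show ?thesis using True by simp
      qed simp
      have i: "integrable M (\<lambda>x. (real (Suc n))\<^sup>2 *
          (2 * (cmod (F x))\<^sup>2 + 2 * (indicator K x * (cmod (F x - p x))\<^sup>2)))"
        using bd[OF K(1)] L2_integrable[OF F] by (intro integrable_mult_right Bochner_Integration.integrable_add) auto
      have "measure M K = (\<integral>x. indicator K x \<partial>M)" using cpt[OF K(1)] by simp
      also have "\<dots> \<le> (\<integral>x. (real (Suc n))\<^sup>2 *
          (2 * (cmod (F x))\<^sup>2 + 2 * (indicator K x * (cmod (F x - p x))\<^sup>2)) \<partial>M)"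
        using cpt[OF K(1)] le by (intro integral_mono i) (auto simp: less_top)
      also have "\<dots> = (real (Suc n))\<^sup>2 * (2 * sqnorm M F +
          2 * (\<integral>x. indicator K x * (cmod (F x - p x))\<^sup>2 \<partial>M))"
        using bd[OF K(1)] L2_integrable[OF F]
        by (subst integral_mult_right_zero, subst Bochner_Integration.integral_add) auto
      also have "\<dots> \<le> C"
        unfolding C_def using bd[OF K(1)] by (intro mult_left_mono) auto
      finally show ?thesis
        using cpt[OF K(1)] by (simp add: emeasure_eq_ennreal_measure ennreal_leI less_top)
    qed
    then have "emeasure M (P n) \<le> ennreal C"
      unfolding haar_emeasure_SUP[OF M P_open] by (intro SUP_least) blast
    then show ?thesis using le_less_trans[OF _ ennreal_less_top] by simp
  qed
  have Q_fin: "emeasure M (Q n) < \<infinity>" for n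
    using L2_level_set_finite[OF F, of n] by (simp add: Q_def)
  have PQ: "P n \<in> sets M" "Q n \<in> sets M" for n
  proof -
    show "P n \<in> sets M" using P_open by (simp add: haar_sets[OF M])
    have "{x \<in> space M. cmod (F x) > 1 / Suc n} \<in> sets M" by measurable
    then show "Q n \<in> sets M" by (simp add: Q_def)
  qed
  have "emeasure M (P n \<union> Q n) < \<infinity>" for n
    by (rule le_less_trans[OF emeasure_subadditive[OF PQ]]) (use P_fin[of n] Q_fin[of n] in simp)
  then obtain D where D: "\<And>n. compact (D n)" "incseq D"
      "(\<Union>n. P n \<union> Q n) - (\<Union>n. D n) \<in> null_sets M"
    using sigma_finite_compact_exhaustion[OF M, of "\<lambda>n. P n \<union> Q n"] PQ haar_sets[OF M] by auto
  have zero: "F x - p x = 0" if "x \<notin> (\<Union>n. P n \<union> Q n)" for x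
  proof -
    have small: "u = 0" if "\<And>n. \<not> 1 / Suc n < cmod u" for u :: complex
    proof (rule ccontr)
      assume "u \<noteq> 0"
      then obtain n where "inverse (real (Suc n)) < cmod u" using reals_Archimedean[of "cmod u"] by auto
      then show False using that[of n] by (simp add: inverse_eq_divide)
    qed
    have "p x = 0" "F x = 0" using that by (auto intro!: small simp: P_def Q_def)
    then show ?thesis by simp
  qed
  have "(\<integral>\<^sup>+x. ennreal ((cmod (F x - p x))\<^sup>2) \<partial>M) =
      (\<integral>\<^sup>+x. (SUP n. ennreal (indicator (D n) x * (cmod (F x - p x))\<^sup>2)) \<partial>M)"
  proof (rule nn_integral_cong_AE, use AE_not_in[OF D(3)] in eventually_elim)
    case (elim x)
    show ?case
    proof (cases "\<exists>n. x \<in> D n")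
      case True
      then obtain n where "x \<in> D n" ..
      then show ?thesis
        by (intro antisym SUP_upper2[of n] SUP_least) (auto split: split_indicator)
    next
      case False
      with elim zero[of x] have "F x - p x = 0" by auto
      then show ?thesis by simp
    qed
  qed
  also have "\<dots> = (SUP n. \<integral>\<^sup>+x. ennreal (indicator (D n) x * (cmod (F x - p x))\<^sup>2) \<partial>M)"
  proof (rule nn_integral_monotone_convergence_SUP)
    show "incseq (\<lambda>n x. ennreal (indicator (D n) x * (cmod (F x - p x))\<^sup>2))"
      using D(2) by (auto simp: incseq_def le_fun_def split: split_indicator)
    show "(\<lambda>x. ennreal (indicator (D n) x * (cmod (F x - p x))\<^sup>2)) \<in> borel_measurable M" for n
      using cpt(1)[OF D(1)[of n]] by measurable
  qed
  also have "\<dots> \<le> ennreal B"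
  proof (rule SUP_least)
    fix n
    show "(\<integral>\<^sup>+x. ennreal (indicator (D n) x * (cmod (F x - p x))\<^sup>2) \<partial>M) \<le> ennreal B"
      using bd[OF D(1)[of n]] by (subst nn_integral_eq_integral) (auto intro: ennreal_leI)
  qed
  finally have le: "(\<integral>\<^sup>+x. ennreal ((cmod (F x - p x))\<^sup>2) \<partial>M) \<le> ennreal B" .
  show *: "L2 M (\<lambda>x. F x - p x)" unfolding L2_def
    using le_less_trans[OF le ennreal_less_top] by (intro conjI integrableI_nonneg) auto
  have "ennreal (sqnorm M (\<lambda>x. F x - p x)) \<le> ennreal B"
    using le * by (subst nn_integral_eq_integral[symmetric]) (auto simp: L2_def)
  then show "sqnorm M (\<lambda>x. F x - p x) \<le> B" using B0 by simp
qed

section \<open>Characters\<close>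

lemma pairing_diff_right: "pairing c (x - y) = pairing c x * cnj (pairing c y)"
proof -
  have "pairing c (x - y) * pairing c y = pairing c x"
    by (simp add: pairing_add_right[symmetric])
  then have "pairing c (x - y) * (pairing c y * cnj (pairing c y)) = pairing c x * cnj (pairing c y)"
    by (simp add: mult.assoc[symmetric])
  then show ?thesis by (simp add: complex_norm_square[symmetric])
qed

lemma pairing_measurable:
  fixes M :: "'a::topological_ab_group_add measure"
  shows "sets M = sets borel \<Longrightarrow> pairing c \<in> borel_measurable M"
  using borel_measurable_continuous_onI[OF pairing_continuous, of c]
    measurable_cong_sets[of M borel borel borel] by simp

lemma evaluation_continuous:
  fixes x :: "'a::topological_ab_group_add"
  shows "continuous_on UNIV (\<lambda>c. pairing c x)"
  unfolding continuous_on_def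
proof
  fix c :: "'a dual_group"
  have "((\<lambda>d. d) \<longlongrightarrow> c) (at c)" by (rule tendsto_ident_at)
  then have "\<forall>\<^sub>F d in at c. \<forall>y\<in>{x}. cmod (pairing d y - pairing c y) < e" if "e > 0" for e
    using that compact_sing[of x] unfolding tendsto_dual_group_iff by blast
  then show "((\<lambda>c. pairing c x) \<longlongrightarrow> pairing c x) (at c within UNIV)"
    by (simp add: tendsto_iff dist_norm)
qed

lemma evaluation_measurable:
  fixes N :: "'a::topological_ab_group_add dual_group measure"
  shows "sets N = sets borel \<Longrightarrow> (\<lambda>c. pairing c x) \<in> borel_measurable N"
  using borel_measurable_continuous_onI[OF evaluation_continuous[of x]]
    measurable_cong_sets[of N borel borel borel] by simp

text \<open>The topology of the dual group is that of compact convergence, so on a compact neighbourhood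
  of \<open>x\<close> every character of a compact set is uniformly close to one of finitely many, and these
  are continuous at \<open>x\<close>.\<close>

lemma compact_dual_equicontinuous:
  fixes C :: "'a::topological_ab_group_add dual_group set" and x :: 'a
  assumes lc: "locally compact (UNIV :: 'a set)" and C: "compact C" and e: "e > 0"
  shows "\<exists>U. open U \<and> x \<in> U \<and> (\<forall>y\<in>U. \<forall>c\<in>C. cmod (pairing c y - pairing c x) < e)"
proof -
  obtain V K where V: "openin (top_of_set UNIV) V" "compact K" "x \<in> V" "V \<subseteq> K"
    using locallyE[OF lc, of UNIV x] by auto
  define N where "N c = {d. \<forall>y\<in>K. cmod (pairing d y - pairing c y) < e / 3}" for c :: "'a dual_group"
  have N: "open (N c)" "c \<in> N c" for c
    using open_dual_nbhd[OF V(2), of c "e / 3"] e by (auto simp: N_def)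
  have "C \<subseteq> (\<Union>c\<in>C. N c)" using N(2) by blast
  from compactE_image[OF C N(1) this]
  obtain C' where C': "C' \<subseteq> C" "finite C'" "C \<subseteq> (\<Union>c\<in>C'. N c)" by metis
  define U where "U = V \<inter> (\<Inter>c\<in>C'. {y. cmod (pairing c y - pairing c x) < e / 3})"
  have "open {y. cmod (pairing c y - pairing c x) < e / 3}" for c
    by (intro open_Collect_less continuous_intros pairing_continuous)
  then have "open U" unfolding U_def using V(1) C'(2) by (intro open_Int open_INT) auto
  moreover have "x \<in> U" using V(3) e by (simp add: U_def)
  moreover have "cmod (pairing d y - pairing d x) < e" if y: "y \<in> U" and d: "d \<in> C" for y d
  proof -
    obtain c where c: "c \<in> C'" "d \<in> N c" using C'(3) d by blast
    have "cmod (pairing d y - pairing c y) < e / 3" "cmod (pairing d x - pairing c x) < e / 3"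
      using c(2) V(3,4) y by (auto simp: N_def U_def)
    moreover have "cmod (pairing c y - pairing c x) < e / 3" using y c(1) by (simp add: U_def)
    moreover have "cmod (pairing d y - pairing d x) \<le> cmod (pairing d y - pairing c y)
        + cmod (pairing c y - pairing c x) + cmod (pairing d x - pairing c x)"
      using norm_triangle_ineq[of "pairing d y - pairing c y + (pairing c y - pairing c x)" "pairing c x - pairing d x"]
        norm_triangle_ineq[of "pairing d y - pairing c y" "pairing c y - pairing c x"]
      by (simp add: norm_minus_commute)
    ultimately show ?thesis by linarith
  qed
  ultimately show ?thesis by blast
qed

text \<open>Without countability assumptions the product of two Borel \<open>\<sigma>\<close>-algebras can be smaller
  than the Borel \<open>\<sigma>\<close>-algebra of the product, so continuity of the pairing does not make it
  measurable. On a compact rectangle, equicontinuity makes it a uniform limit of functions that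
  depend on \<open>x\<close> only through a finite Borel partition.\<close>

lemma pairing_measurable_compact_rectangle:
  fixes N :: "'a::{topological_ab_group_add, t2_space} dual_group measure" and M :: "'a measure"
  assumes lc: "locally compact (UNIV :: 'a set)"
    and sets: "sets N = sets borel" "sets M = sets borel"
    and C: "compact C" and K: "compact K"
  shows "(\<lambda>(c, x). indicator C c * indicator K x * pairing c x) \<in> borel_measurable (N \<Otimes>\<^sub>M M)"
proof -
  have [measurable]: "C \<in> sets N" "K \<in> sets M" "(\<lambda>c. pairing c x) \<in> borel_measurable N" for x
    using sets C K evaluation_measurable by (auto intro: borel_closed compact_imp_closed)
  have "\<exists>V f. (\<forall>i::nat. open (V i)) \<and> K \<subseteq> (\<Union>i. V i) \<and>
      (\<forall>i. \<forall>y\<in>V i. \<forall>c\<in>C. cmod (pairing c y - pairing c (f i)) < 1 / Suc n)" for n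
  proof -
    have "\<forall>x. \<exists>U. open U \<and> x \<in> U \<and> (\<forall>y\<in>U. \<forall>c\<in>C. cmod (pairing c y - pairing c x) < 1 / Suc n)"
      using compact_dual_equicontinuous[OF lc C] by simp
    then obtain U where U: "\<And>x. open (U x)" "\<And>x. x \<in> U x"
        "\<And>x y c. y \<in> U x \<Longrightarrow> c \<in> C \<Longrightarrow> cmod (pairing c y - pairing c x) < 1 / Suc n"
      by metis
    have "K \<subseteq> (\<Union>x\<in>K. U x)" using U(2) by blast
    from compactE_image[OF K U(1) this]
    obtain X where X: "X \<subseteq> K" "finite X" "K \<subseteq> (\<Union>x\<in>X. U x)" by metis
    obtain xs where xs: "set xs = X" using finite_list[OF X(2)] by blast
    define V where "V i = (if i < length xs then U (xs ! i) else {})" for i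
    have "K \<subseteq> (\<Union>i. V i)"
    proof
      fix y assume "y \<in> K"
      then obtain x where "x \<in> set xs" "y \<in> U x" using X(3) xs by blast
      then obtain i where "i < length xs" "y \<in> U (xs ! i)" by (auto simp: in_set_conv_nth)
      then have "y \<in> V i" by (simp add: V_def)
      then show "y \<in> (\<Union>i. V i)" by blast
    qed
    moreover have "open (V i)" for i using U(1) by (simp add: V_def)
    moreover have "cmod (pairing c y - pairing c (xs ! i)) < 1 / Suc n" if "y \<in> V i" "c \<in> C" for i y c
      using that U(3) by (auto simp: V_def split: if_splits)
    ultimately show ?thesis by (intro exI[of _ V] exI[of _ "\<lambda>i. xs ! i"]) blast
  qed
  then obtain V f where V: "\<And>n i::nat. open (V n i)" "\<And>n. K \<subseteq> (\<Union>i. V n i)"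
      "\<And>n i y c. y \<in> V n i \<Longrightarrow> c \<in> C \<Longrightarrow> cmod (pairing c y - pairing c (f n i)) < 1 / Suc n"
    by metis
  \<comment> \<open>the finite Borel partition: \<open>y\<close> is sent to the first neighbourhood that contains it\<close>
  define idx where "idx n y = (LEAST i. y \<in> V n i)" for n y
  have [measurable]: "V n i \<in> sets M" for n i using V(1) sets by simp
  have idx_meas [measurable]: "idx n \<in> measurable M (count_space UNIV)" for n
    unfolding idx_def by measurable
  show ?thesis
  proof (rule borel_measurable_LIMSEQ_metric)
    fix n
    have "(\<lambda>z. (\<lambda>(i::nat) (z :: 'a dual_group \<times> 'a). indicator C (fst z) * indicator K (snd z) * pairing (fst z) (f n i))
        (idx n (snd z)) z) \<in> borel_measurable (N \<Otimes>\<^sub>M M)"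
      by (rule measurable_compose_countable) measurable
    then show "(\<lambda>z. indicator C (fst z) * indicator K (snd z) * pairing (fst z) (f n (idx n (snd z))))
        \<in> borel_measurable (N \<Otimes>\<^sub>M M)" .
  next
    fix z :: "'a dual_group \<times> 'a"
    obtain c y where z: "z = (c, y)" by (cases z)
    have bd: "norm (indicator C c * indicator K y * pairing c (f n (idx n y))
        - indicator C c * indicator K y * pairing c y) \<le> 1 / Suc n" for n
    proof (cases "c \<in> C \<and> y \<in> K")
      case True
      then obtain i where "y \<in> V n i" using V(2) by blast
      then have "y \<in> V n (idx n y)" unfolding idx_def by (rule LeastI)
      from V(3)[OF this] True show ?thesis by (simp add: norm_minus_commute less_imp_le)
    qed auto
    have "(\<lambda>n. indicator C c * indicator K y * pairing c (f n (idx n y))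
        - indicator C c * indicator K y * pairing c y) \<longlonglongrightarrow> 0"
      by (rule Lim_null_comparison[OF always_eventually])
         (use bd LIMSEQ_Suc[OF lim_1_over_n] in auto)
    then show "(\<lambda>n. indicator C (fst z) * indicator K (snd z) * pairing (fst z) (f n (idx n (snd z))))
        \<longlonglongrightarrow> (case z of (c, x) \<Rightarrow> indicator C c * indicator K x * pairing c x)"
      unfolding z by (simp add: LIM_zero_iff)
  qed
qed

section \<open>Fourier integrals\<close>

lemma sigma_finite_haar_exhaustion:
  fixes M :: "'a::{topological_ab_group_add, t2_space} measure"
  assumes M: "haar_measure M" "sigma_finite_measure M"
  obtains D :: "nat \<Rightarrow> 'a set" where "\<And>n. compact (D n)" "incseq D" "AE x in M. x \<in> (\<Union>n. D n)"
proof -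
  obtain A :: "nat \<Rightarrow> 'a set" where A: "range A \<subseteq> sets M" "(\<Union>n. A n) = space M" "\<And>n. emeasure M (A n) \<noteq> \<infinity>"
    using sigma_finite_measure.sigma_finite[OF M(2)] by metis
  obtain D where D: "\<And>n. compact (D n)" "incseq D" "(\<Union>n. A n) - (\<Union>n. D n) \<in> null_sets M"
    using sigma_finite_compact_exhaustion[OF M(1), of A] A(1,3) haar_sets[OF M(1)]
    by (metis infinity_ennreal_def range_subsetD top.not_eq_extremum)
  have "AE x in M. x \<in> (\<Union>n. D n)"
    using AE_not_in[OF D(3)] AE_space[of M] by eventually_elim (use A(2) in auto)
  then show thesis using that D by blast
qed

lemma integrable_mult_pairing:
  assumes "sets N = sets borel" "integrable N h"
  shows "integrable N (\<lambda>c. h c * pairing c x)"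
proof -
  note [measurable] = evaluation_measurable[OF assms(1)] borel_measurable_integrable[OF assms(2)]
  show ?thesis
    by (rule Bochner_Integration.integrable_bound[OF assms(2)]) (auto simp: norm_mult)
qed

lemma integrable_mult_cnj_pairing:
  assumes "sets M = sets borel" "integrable M f"
  shows "integrable M (\<lambda>x. f x * cnj (pairing c x))"
proof -
  note [measurable] = pairing_measurable[OF assms(1)] borel_measurable_integrable[OF assms(2)]
  have [measurable]: "(\<lambda>x. cnj (pairing c x)) \<in> borel_measurable M"
    by (rule borel_measurable_continuous_on[OF _ pairing_measurable[OF assms(1)]])
       (rule continuous_on_cnj[OF continuous_on_id])
  show ?thesis
    by (rule Bochner_Integration.integrable_bound[OF assms(2)]) (auto simp: norm_mult)
qed

lemma fourier_add:
  assumes "sets M = sets borel" "integrable M f" "integrable M g"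
  shows "fourier M (\<lambda>x. f x + g x) c = fourier M f c + fourier M g c"
  using assms integrable_mult_cnj_pairing[OF assms(1)] by (simp add: fourier_def distrib_right)

lemma fourier_cmult: "fourier M (\<lambda>x. a * f x) c = a * fourier M f c"
  by (simp add: fourier_def mult.assoc)

lemma inv_fourier_add:
  assumes "sets N = sets borel" "integrable N f" "integrable N g"
  shows "inv_fourier N (\<lambda>c. f c + g c) x = inv_fourier N f x + inv_fourier N g x"
  using assms integrable_mult_pairing[OF assms(1)] by (simp add: inv_fourier_def distrib_right)

lemma inv_fourier_cmult: "inv_fourier N (\<lambda>c. a * f c) x = a * inv_fourier N f x"
  by (simp add: inv_fourier_def mult.assoc)

lemma inv_fourier_bound:
  assumes "sets N = sets borel" "integrable N h"
  shows "cmod (inv_fourier N h x) \<le> (\<integral>c. cmod (h c) \<partial>N)"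
  unfolding inv_fourier_def
  using integral_norm_bound[of N "\<lambda>c. h c * pairing c x"] by (simp add: norm_mult)

text \<open>Up to a small part of the integral, the integration runs over a compact set of characters,
  which is equicontinuous.\<close>

lemma inv_fourier_continuous:
  fixes N :: "'a::{topological_ab_group_add, t2_space} dual_group measure"
  assumes lc: "locally compact (UNIV :: 'a set)"
    and N: "haar_measure N" "sigma_finite_measure N" and h: "integrable N h"
  shows "continuous_on UNIV (inv_fourier N h)"
  unfolding continuous_on_def
proof
  fix x
  obtain D where D: "\<And>n. compact (D n)" "incseq D" "AE c in N. c \<in> (\<Union>n. D n)"
    using sigma_finite_haar_exhaustion[OF N] by blast
  note setsN = haar_sets[OF N(1)]
  note [measurable] = borel_measurable_integrable[OF h]
  have [measurable]: "D n \<in> sets N" for n using haar_compact[OF N(1) D(1)] by auto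
  have "(\<lambda>n. \<integral>c. indicator (- D n) c * cmod (h c) \<partial>N) \<longlonglongrightarrow> (\<integral>c. 0 \<partial>N)"
  proof (rule integral_dominated_convergence)
    show "integrable N (\<lambda>c. cmod (h c))" using h by simp
    show "AE c in N. (\<lambda>n. indicator (- D n) c * cmod (h c)) \<longlonglongrightarrow> 0"
      using D(3)
    proof eventually_elim
      case (elim c)
      then obtain m where "c \<in> D m" by blast
      then have "c \<in> D n" if "n \<ge> m" for n using that D(2) by (auto simp: incseq_def)
      then have "\<forall>\<^sub>F n in sequentially. indicator (- D n) c * cmod (h c) = 0"
        by (auto simp: eventually_sequentially intro!: exI[of _ m])
      then show ?case by (rule tendsto_eventually)
    qed
    show "(\<lambda>c. indicator (- D n) c * cmod (h c)) \<in> borel_measurable N" for n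
      by (simp add: indicator_compl)
    show "AE c in N. norm (indicator (- D n) c * cmod (h c)) \<le> cmod (h c)" for n
      by (auto split: split_indicator)
  qed simp
  then have tail: "(\<lambda>n. \<integral>c. indicator (- D n) c * cmod (h c) \<partial>N) \<longlonglongrightarrow> 0" by simp
  show "(inv_fourier N h \<longlongrightarrow> inv_fourier N h x) (at x within UNIV)"
    unfolding tendsto_iff
  proof (intro allI impI)
    fix e :: real assume e: "e > 0"
    then obtain n where n: "(\<integral>c. indicator (- D n) c * cmod (h c) \<partial>N) < e / 4"
      using order_tendstoD(2)[OF tail, of "e / 4"] by (auto simp: eventually_sequentially)
    define B where "B = (\<integral>c. cmod (h c) \<partial>N) + 1"
    have B: "B > 0" unfolding B_def by (intro add_nonneg_pos) auto
    obtain U where U: "open U" "x \<in> U"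
      "\<And>y c. y \<in> U \<Longrightarrow> c \<in> D n \<Longrightarrow> cmod (pairing c y - pairing c x) < e / (2 * B)"
      using compact_dual_equicontinuous[OF lc D(1), of "e / (2 * B)" x n] e B by force
    have "dist (inv_fourier N h y) (inv_fourier N h x) < e" if y: "y \<in> U" for y
    proof -
      have i: "integrable N (\<lambda>c. 2 * (indicator (- D n) c * cmod (h c)))"
        by (intro integrable_mult_right Bochner_Integration.integrable_bound[OF h])
           (auto simp: indicator_compl split: split_indicator)
      have "inv_fourier N h y - inv_fourier N h x = (\<integral>c. h c * (pairing c y - pairing c x) \<partial>N)"
        unfolding inv_fourier_def right_diff_distrib
        by (rule Bochner_Integration.integral_diff[symmetric])
           (intro integrable_mult_pairing[OF setsN h])+
      also have "cmod \<dots> \<le> (\<integral>c. 2 * (indicator (- D n) c * cmod (h c)) + e / (2 * B) * cmod (h c) \<partial>N)"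
      proof (rule order_trans[OF integral_norm_bound integral_mono])
        show "integrable N (\<lambda>c. norm (h c * (pairing c y - pairing c x)))"
          unfolding right_diff_distrib
          by (intro integrable_norm Bochner_Integration.integrable_diff integrable_mult_pairing[OF setsN h])
        show "integrable N (\<lambda>c. 2 * (indicator (- D n) c * cmod (h c)) + e / (2 * B) * cmod (h c))"
          using i h by (intro Bochner_Integration.integrable_add integrable_mult_right) auto
        fix c
        show "norm (h c * (pairing c y - pairing c x))
            \<le> 2 * (indicator (- D n) c * cmod (h c)) + e / (2 * B) * cmod (h c)"
        proof (cases "c \<in> D n")
          case True
          then show ?thesis using mult_left_mono[OF less_imp_le[OF U(3)[OF y True]], of "cmod (h c)"]
            by (simp add: norm_mult mult.commute)
        next
          case False
          have "cmod (pairing c y - pairing c x) \<le> 2"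
            using norm_triangle_ineq4[of "pairing c y" "pairing c x"] by simp
          from mult_left_mono[OF this, of "cmod (h c)"]
          have "norm (h c * (pairing c y - pairing c x)) \<le> 2 * cmod (h c)"
            by (simp add: norm_mult mult.commute)
          moreover have "0 \<le> e / (2 * B) * cmod (h c)" using e B by simp
          ultimately show ?thesis using False by simp
        qed
      qed
      also have "\<dots> = 2 * (\<integral>c. indicator (- D n) c * cmod (h c) \<partial>N) + e / (2 * B) * (B - 1)"
        using i h by (subst Bochner_Integration.integral_add) (auto simp: B_def)
      also have "\<dots> < 2 * (e / 4) + e / (2 * B) * B"
        using n e B by (intro add_strict_mono mult_strict_left_mono) auto
      also have "\<dots> = e" using B by simp
      finally show ?thesis by (simp add: dist_norm)
    qed
    then show "\<forall>\<^sub>F y in at x within UNIV. dist (inv_fourier N h y) (inv_fourier N h x) < e"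
      using U(1,2) unfolding eventually_at_topological by blast
  qed
qed

text \<open>Fubini's theorem for the kernel \<open>h(c) c(x) cnj (g x)\<close>. The exhaustion of the
  \<open>\<sigma>\<close>-finite dual group and the compact support of \<open>g\<close> bring it into the range of the
  measurability result for compact rectangles; the support also makes up for the missing
  \<open>\<sigma>\<close>-finiteness of \<open>M\<close>.\<close>

lemma inv_fourier_duality:
  fixes N :: "'a::{topological_ab_group_add, t2_space} dual_group measure" and M :: "'a measure"
  assumes lc: "locally compact (UNIV :: 'a set)"
    and M: "haar_measure M" and N: "haar_measure N" "sigma_finite_measure N"
    and h: "integrable N h" and g: "integrable M g"
    and K: "compact K" "\<And>x. x \<notin> K \<Longrightarrow> g x = 0"
    and ghat: "fourier M g \<in> borel_measurable N"
  shows "(\<integral>x. inv_fourier N h x * cnj (g x) \<partial>M) = (\<integral>c. h c * cnj (fourier M g c) \<partial>N)"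
proof -
  obtain D where D: "\<And>n. compact (D n)" "incseq D" "AE c in N. c \<in> (\<Union>n. D n)"
    using sigma_finite_haar_exhaustion[OF N] by blast
  define E where "E = (\<Union>n. D n)"
  have setsN: "sets N = sets borel" and setsM: "sets M = sets borel"
    using haar_sets M N by auto
  have [measurable]: "D n \<in> sets N" for n using haar_compact[OF N(1) D(1)] by auto
  have KM [measurable]: "K \<in> sets M" and Kfin: "emeasure M K < \<infinity>" using haar_compact[OF M K(1)] by auto
  have [measurable]: "E \<in> sets N" unfolding E_def by measurable
  have [measurable]: "h \<in> borel_measurable N" "g \<in> borel_measurable M" using h g by auto
  have cnj_meas: "(\<lambda>z. cnj (f z)) \<in> borel_measurable L" if "f \<in> borel_measurable L" for f and L :: "'c measure"
    by (rule borel_measurable_continuous_on[OF _ that]) (rule continuous_on_cnj[OF continuous_on_id])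
  \<comment> \<open>cutting \<open>M\<close> off with a density keeps its \<open>\<sigma>\<close>-algebra\<close>
  define MK where "MK = density M (\<lambda>x. ennreal (indicator K x))"
  have setsMK [measurable_cong]: "sets MK = sets M" by (simp add: MK_def)
  have "finite_measure MK"
  proof
    have "emeasure MK (space MK) = emeasure M K"
      by (simp add: MK_def emeasure_density ennreal_indicator nn_integral_indicator
          indicator_inter_arith[symmetric] Int_absorb2 sets.sets_into_space[OF KM])
    then show "emeasure MK (space MK) \<noteq> \<infinity>" using Kfin by simp
  qed
  then interpret MK: finite_measure MK .
  interpret N: sigma_finite_measure N by (rule N(2))
  interpret P: pair_sigma_finite N MK ..
  have int_MK: "(\<integral>x. f x \<partial>MK) = (\<integral>x. f x \<partial>M)"
    if "f \<in> borel_measurable M" "\<And>x. x \<notin> K \<Longrightarrow> f x = 0" for f :: "'a \<Rightarrow> complex"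
  proof -
    have "(\<integral>x. f x \<partial>MK) = (\<integral>x. indicator K x *\<^sub>R f x \<partial>M)"
      unfolding MK_def using that(1) by (intro integral_density) auto
    also have "\<dots> = (\<integral>x. f x \<partial>M)"
      using that(2) by (intro Bochner_Integration.integral_cong) (auto split: split_indicator)
    finally show ?thesis .
  qed
  define \<kappa> where "\<kappa> c x = indicator E c * indicator K x * pairing c x" for c x
  have \<kappa>_le: "cmod (\<kappa> c x) \<le> 1" for c x by (auto simp: \<kappa>_def norm_mult split: split_indicator)
  have \<kappa>_meas [measurable]: "(\<lambda>(c, x). \<kappa> c x) \<in> borel_measurable (N \<Otimes>\<^sub>M MK)"
  proof (rule borel_measurable_LIMSEQ_metric)
    fix n
    show "(\<lambda>(c, x). indicator (D n) c * indicator K x * pairing c x) \<in> borel_measurable (N \<Otimes>\<^sub>M MK)"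
      using setsMK setsN setsM by (intro pairing_measurable_compact_rectangle lc D K) auto
  next
    fix z :: "'a dual_group \<times> 'a"
    obtain c x where z: "z = (c, x)" by (cases z)
    have "(\<lambda>n. indicator (D n) c :: complex) \<longlonglongrightarrow> indicator E c"
      unfolding E_def by (rule LIMSEQ_indicator_incseq[OF D(2)])
    then show "(\<lambda>n. case z of (c, x) \<Rightarrow> indicator (D n) c * indicator K x * pairing c x)
        \<longlonglongrightarrow> (case z of (c, x) \<Rightarrow> \<kappa> c x)"
      unfolding z \<kappa>_def prod.case by (intro tendsto_intros)
  qed
  have g_MK: "integrable MK (\<lambda>x. cmod (g x))"
  proof -
    have "integrable M (\<lambda>x. indicator K x *\<^sub>R cmod (g x))"
      by (rule Bochner_Integration.integrable_bound[OF g]) (auto split: split_indicator)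
    then show ?thesis unfolding MK_def by (subst integrable_density) auto
  qed
  have prod_int: "integrable (N \<Otimes>\<^sub>M MK) (\<lambda>(c, x). cmod (h c) * cmod (g x))"
  proof (rule P.Fubini_integrable)
    show "integrable N (\<lambda>c. \<integral>x. norm (case (c, x) of (c, x) \<Rightarrow> cmod (h c) * cmod (g x)) \<partial>MK)"
      using h by simp
    show "AE c in N. integrable MK (\<lambda>x. case (c, x) of (c, x) \<Rightarrow> cmod (h c) * cmod (g x))"
      using g_MK by simp
  qed measurable
  have int: "integrable (N \<Otimes>\<^sub>M MK) (\<lambda>(c, x). h c * cnj (g x) * \<kappa> c x)"
  proof (rule Bochner_Integration.integrable_bound[OF prod_int])
    have "(\<lambda>x. cnj (g x)) \<in> borel_measurable MK" by (rule cnj_meas) measurable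
    then show "(\<lambda>(c, x). h c * cnj (g x) * \<kappa> c x) \<in> borel_measurable (N \<Otimes>\<^sub>M MK)"
      using \<kappa>_meas by measurable
    show "AE z in N \<Otimes>\<^sub>M MK. norm (case z of (c, x) \<Rightarrow> h c * cnj (g x) * \<kappa> c x)
        \<le> norm (case z of (c, x) \<Rightarrow> cmod (h c) * cmod (g x))"
      using \<kappa>_le by (intro AE_I2) (auto simp: norm_mult split: prod.split intro!: mult_left_le)
  qed
  have inner: "(\<integral>c. h c * cnj (g x) * \<kappa> c x \<partial>N) = inv_fourier N h x * cnj (g x)" for x
  proof -
    have "(\<integral>c. h c * cnj (g x) * \<kappa> c x \<partial>N) = (\<integral>c. (h c * pairing c x) * cnj (g x) \<partial>N)"
    proof (rule integral_cong_AE)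
      note [measurable] = evaluation_measurable[OF setsN, of x]
      show "(\<lambda>c. h c * cnj (g x) * \<kappa> c x) \<in> borel_measurable N" unfolding \<kappa>_def by measurable
      show "(\<lambda>c. (h c * pairing c x) * cnj (g x)) \<in> borel_measurable N" by measurable
      show "AE c in N. h c * cnj (g x) * \<kappa> c x = (h c * pairing c x) * cnj (g x)"
        using D(3)
        by eventually_elim (use K(2)[of x] in \<open>auto simp: \<kappa>_def E_def split: split_indicator\<close>)
    qed
    then show ?thesis by (simp add: inv_fourier_def)
  qed
  have outer: "(\<integral>x. h c * cnj (g x) * \<kappa> c x \<partial>MK) = indicator E c * (h c * cnj (fourier M g c))" for c
  proof -
    note [measurable] = pairing_measurable[OF setsM, of c] cnj_meas[of g M]
    have "(\<integral>x. h c * cnj (g x) * \<kappa> c x \<partial>MK) = (\<integral>x. h c * cnj (g x) * \<kappa> c x \<partial>M)"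
      by (rule int_MK) (auto simp: \<kappa>_def)
    also have "\<dots> = (\<integral>x. (indicator E c * h c) * cnj (g x * cnj (pairing c x)) \<partial>M)"
      using K(2) by (intro Bochner_Integration.integral_cong) (auto simp: \<kappa>_def split: split_indicator)
    finally show ?thesis
      by (simp only: integral_mult_right_zero Bochner_Integration.integral_cnj fourier_def mult.assoc)
  qed
  have cont: "inv_fourier N h \<in> borel_measurable M"
    using borel_measurable_continuous_onI[OF inv_fourier_continuous[OF lc N h]] haar_measurable[OF M]
    by auto
  have "(\<integral>x. inv_fourier N h x * cnj (g x) \<partial>M) = (\<integral>x. inv_fourier N h x * cnj (g x) \<partial>MK)"
    using cont cnj_meas[of g M] K(2) by (intro int_MK[symmetric]) auto
  also have "\<dots> = (\<integral>x. \<integral>c. h c * cnj (g x) * \<kappa> c x \<partial>N \<partial>MK)"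
    by (simp add: inner)
  also have "\<dots> = (\<integral>c. \<integral>x. h c * cnj (g x) * \<kappa> c x \<partial>MK \<partial>N)"
    by (rule P.Fubini_integral[OF int])
  also have "\<dots> = (\<integral>c. indicator E c * (h c * cnj (fourier M g c)) \<partial>N)"
    by (simp add: outer)
  also have "\<dots> = (\<integral>c. h c * cnj (fourier M g c) \<partial>N)"
  proof (rule integral_cong_AE)
    have "(\<lambda>c. \<integral>x. h c * cnj (g x) * \<kappa> c x \<partial>MK) \<in> borel_measurable N"
      by (rule borel_measurable_integrable[OF P.integrable_fst'[OF int, unfolded prod.case]])
    then show A: "(\<lambda>c. indicator E c * (h c * cnj (fourier M g c))) \<in> borel_measurable N"
      by (simp add: outer)
    show "AE c in N. indicator E c * (h c * cnj (fourier M g c)) = h c * cnj (fourier M g c)"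
      using D(3) by eventually_elim (simp add: E_def)
    show "(\<lambda>c. h c * cnj (fourier M g c)) \<in> borel_measurable N"
      using cnj_meas[OF ghat] by measurable
  qed
  finally show ?thesis .
qed

section \<open>The Fourier transform of square integrable functions\<close>

lemma sqnorm_add:
  assumes "L2 M f" "L2 M g"
  shows "sqnorm M (\<lambda>x. f x + g x) = sqnorm M f + sqnorm M g + 2 * Re (\<integral>x. f x * cnj (g x) \<partial>M)"
proof -
  note i = L2_cnj_integrable[OF assms]
  have "(cmod (f x + g x))\<^sup>2 = (cmod (f x))\<^sup>2 + (cmod (g x))\<^sup>2 + 2 * Re (f x * cnj (g x))" for x
    unfolding cmod_power2 by (simp add: power2_eq_square algebra_simps)
  then have "sqnorm M (\<lambda>x. f x + g x) =
      (\<integral>x. (cmod (f x))\<^sup>2 + (cmod (g x))\<^sup>2 + 2 * Re (f x * cnj (g x)) \<partial>M)" by simp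
  also have "\<dots> = (\<integral>x. (cmod (f x))\<^sup>2 + (cmod (g x))\<^sup>2 \<partial>M) + (\<integral>x. 2 * Re (f x * cnj (g x)) \<partial>M)"
    by (rule Bochner_Integration.integral_add)
       (intro Bochner_Integration.integrable_add integrable_mult_right integrable_Re[OF i]
         L2_integrable assms)+
  also have "\<dots> = sqnorm M f + sqnorm M g + 2 * Re (\<integral>x. f x * cnj (g x) \<partial>M)"
    unfolding integral_mult_right_zero integral_Re[OF i]
    by (subst Bochner_Integration.integral_add) (use assms in \<open>auto simp: L2_integrable\<close>)
  finally show ?thesis .
qed

context
  fixes \<mu> :: "'a::{topological_ab_group_add, t2_space} measure" and \<nu> :: "'a dual_group measure"
  assumes haar: "haar_measure \<mu>" "haar_measure \<nu>" and norm: "fourier_normalized \<mu> \<nu>"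
begin

lemma plancherel:
  assumes "integrable \<mu> f" "L2 \<mu> f"
  shows "L2 \<nu> (fourier \<mu> f)" "sqnorm \<nu> (fourier \<mu> f) = sqnorm \<mu> f"
  using norm[unfolded fourier_normalized_def, THEN conjunct2, THEN conjunct1] assms by auto

lemma fourier_dense:
  assumes "L2 \<nu> h" "e > 0"
  obtains f where "integrable \<mu> f" "L2 \<mu> f" "sqnorm \<nu> (\<lambda>c. fourier \<mu> f c - h c) < e"
  using norm[unfolded fourier_normalized_def, THEN conjunct2, THEN conjunct2] assms by blast

lemma fourier_diff:
  assumes "integrable \<mu> f" "integrable \<mu> g"
  shows "fourier \<mu> (\<lambda>x. f x - g x) c = fourier \<mu> f c - fourier \<mu> g c"
  using fourier_add[OF haar_sets[OF haar(1)] assms(1), of "\<lambda>x. - 1 * g x"] assms(2)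
    fourier_cmult[of \<mu> "-1" g] by simp

text \<open>Polarisation: the isometry preserves \<open>Re \<langle>f, g\<rangle>\<close> and, applied to \<open>i f\<close>, also the
  imaginary part.\<close>

lemma parseval:
  assumes f: "integrable \<mu> f" "L2 \<mu> f" and g: "integrable \<mu> g" "L2 \<mu> g"
  shows "(\<integral>x. f x * cnj (g x) \<partial>\<mu>) = (\<integral>c. fourier \<mu> f c * cnj (fourier \<mu> g c) \<partial>\<nu>)"
proof -
  have Re_eq: "Re (\<integral>x. f x * cnj (g x) \<partial>\<mu>) = Re (\<integral>c. fourier \<mu> f c * cnj (fourier \<mu> g c) \<partial>\<nu>)"
    if f: "integrable \<mu> f" "L2 \<mu> f" for f
  proof -
    have "fourier \<mu> (\<lambda>x. f x + g x) = (\<lambda>c. fourier \<mu> f c + fourier \<mu> g c)"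
      by (rule ext) (rule fourier_add[OF haar_sets[OF haar(1)] f(1) g(1)])
    with plancherel(2)[of "\<lambda>x. f x + g x"] f g
    have "sqnorm \<nu> (\<lambda>c. fourier \<mu> f c + fourier \<mu> g c) = sqnorm \<mu> (\<lambda>x. f x + g x)"
      by (simp add: L2_add)
    then show ?thesis
      using plancherel[OF f] plancherel[OF g] f g by (simp add: sqnorm_add)
  qed
  define I where "I = (\<integral>x. f x * cnj (g x) \<partial>\<mu>)"
  define J where "J = (\<integral>c. fourier \<mu> f c * cnj (fourier \<mu> g c) \<partial>\<nu>)"
  have "integrable \<mu> (\<lambda>x. \<i> * f x)" using f(1) by simp
  from Re_eq[OF this L2_cmult[OF f(2)]] have "Re (\<i> * I) = Re (\<i> * J)"
    unfolding I_def J_def fourier_cmult mult.assoc integral_mult_right_zero .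
  moreover have "Re I = Re J" unfolding I_def J_def by (rule Re_eq[OF f])
  ultimately have "I = J" by (simp add: complex_eq_iff)
  then show ?thesis unfolding I_def J_def .
qed

text \<open>The extended Fourier transform is well defined almost everywhere: two approximating sequences
  have the same limit, and so do their transforms.\<close>

lemma is_L2_fourier_unique:
  assumes "is_L2_fourier \<mu> \<nu> f h1" "is_L2_fourier \<mu> \<nu> f h2"
  shows "AE c in \<nu>. h1 c = h2 c"
proof -
  obtain F where F: "\<And>n::nat. integrable \<mu> (F n)" "\<And>n. L2 \<mu> (F n)"
      "(\<lambda>n. sqnorm \<mu> (\<lambda>x. F n x - f x)) \<longlonglongrightarrow> 0"
      "(\<lambda>n. sqnorm \<nu> (\<lambda>c. fourier \<mu> (F n) c - h1 c)) \<longlonglongrightarrow> 0"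
    and L: "L2 \<mu> f" "L2 \<nu> h1"
    using assms(1) unfolding is_L2_fourier_def by blast
  obtain G where G: "\<And>n::nat. integrable \<mu> (G n)" "\<And>n. L2 \<mu> (G n)"
      "(\<lambda>n. sqnorm \<mu> (\<lambda>x. G n x - f x)) \<longlonglongrightarrow> 0"
      "(\<lambda>n. sqnorm \<nu> (\<lambda>c. fourier \<mu> (G n) c - h2 c)) \<longlonglongrightarrow> 0"
    and L2: "L2 \<nu> h2"
    using assms(2) unfolding is_L2_fourier_def by blast
  define b where "b n = 2 * sqnorm \<nu> (\<lambda>c. fourier \<mu> (F n) c - h1 c) +
     2 * (2 * (2 * sqnorm \<mu> (\<lambda>x. F n x - f x) + 2 * sqnorm \<mu> (\<lambda>x. G n x - f x)) +
       2 * sqnorm \<nu> (\<lambda>c. fourier \<mu> (G n) c - h2 c))" for n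
  have "sqnorm \<nu> (\<lambda>c. h1 c - h2 c) \<le> b n" for n
  proof -
    note PF = plancherel(1)[OF F(1,2)[of n]] and PG = plancherel(1)[OF G(1,2)[of n]]
    have "sqnorm \<nu> (\<lambda>c. fourier \<mu> (F n) c - fourier \<mu> (G n) c) = sqnorm \<mu> (\<lambda>x. F n x - G n x)"
      using plancherel(2)[OF Bochner_Integration.integrable_diff[OF F(1)[of n] G(1)[of n]] L2_diff[OF F(2)[of n] G(2)[of n]]]
      by (simp add: fourier_diff[OF F(1)[of n] G(1)[of n]])
    also have "\<dots> \<le> 2 * sqnorm \<mu> (\<lambda>x. F n x - f x) + 2 * sqnorm \<mu> (\<lambda>x. G n x - f x)"
      using sqnorm_triangle[OF F(2)[of n] L(1) G(2)[of n]] by (simp only: sqnorm_commute[of \<mu> f])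
    finally have le: "sqnorm \<nu> (\<lambda>c. fourier \<mu> (F n) c - fourier \<mu> (G n) c) \<le>
        2 * sqnorm \<mu> (\<lambda>x. F n x - f x) + 2 * sqnorm \<mu> (\<lambda>x. G n x - f x)" .
    have le2: "sqnorm \<nu> (\<lambda>c. fourier \<mu> (F n) c - h2 c) \<le>
        2 * (2 * sqnorm \<mu> (\<lambda>x. F n x - f x) + 2 * sqnorm \<mu> (\<lambda>x. G n x - f x)) +
        2 * sqnorm \<nu> (\<lambda>c. fourier \<mu> (G n) c - h2 c)"
      by (rule order_trans[OF sqnorm_triangle[OF PF PG L2] add_right_mono[OF mult_left_mono[OF le]]])
         simp
    have "2 * sqnorm \<nu> (\<lambda>c. h1 c - fourier \<mu> (F n) c) +
        2 * sqnorm \<nu> (\<lambda>c. fourier \<mu> (F n) c - h2 c) \<le> b n"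
      unfolding b_def sqnorm_commute[of \<nu> h1] by (intro add_left_mono mult_left_mono le2) simp
    with sqnorm_triangle[OF L(2) PF L2] show ?thesis by (rule order_trans)
  qed
  moreover have "b \<longlonglongrightarrow> 2 * 0 + 2 * (2 * (2 * 0 + 2 * 0) + 2 * 0)"
    unfolding b_def by (intro tendsto_intros F G)
  ultimately have "sqnorm \<nu> (\<lambda>c. h1 c - h2 c) \<le> 2 * 0 + 2 * (2 * (2 * 0 + 2 * 0) + 2 * 0)"
    by (intro LIMSEQ_le_const) auto
  then have "sqnorm \<nu> (\<lambda>c. h1 c - h2 c) = 0"
    by (intro antisym integral_nonneg_AE) auto
  from sqnorm_eq_0_AE[OF L2_diff[OF L(2) L2] this] show ?thesis by simp
qed

text \<open>Let \<open>q = F - p\<close>, where \<open>p\<close> is the inverse Fourier integral of \<open>h\<close>. Testing \<open>q\<close>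
  against the restriction \<open>g\<close> of \<open>q\<close> to a compact set \<open>K\<close> gives, by duality and Parseval's formula,
  \<open>\<integral>\<^sub>K |q|\<^sup>2 = \<langle>fourier F - h, fourier g\<rangle>\<close>, which controls \<open>\<integral>\<^sub>K |q|\<^sup>2\<close> because \<open>g\<close> and its
  transform have the same norm.\<close>

lemma inv_fourier_close:
  assumes lc: "locally compact (UNIV :: 'a set)" and sf: "sigma_finite_measure \<nu>"
    and h: "integrable \<nu> h" "L2 \<nu> h" and F: "integrable \<mu> F" "L2 \<mu> F"
  shows "L2 \<mu> (\<lambda>x. F x - inv_fourier \<nu> h x)"
    and "sqnorm \<mu> (\<lambda>x. F x - inv_fourier \<nu> h x) \<le> sqnorm \<nu> (\<lambda>c. fourier \<mu> F c - h c)"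
proof -
  define p where "p = inv_fourier \<nu> h"
  define B where "B = sqnorm \<nu> (\<lambda>c. fourier \<mu> F c - h c)"
  have p_cont: "continuous_on UNIV p"
    unfolding p_def by (rule inv_fourier_continuous[OF lc haar(2) sf h(1)])
  have [measurable]: "p \<in> borel_measurable \<mu>" "F \<in> borel_measurable \<mu>"
    using borel_measurable_continuous_onI[OF p_cont] haar_measurable[OF haar(1)] F by auto
  have p_bd: "cmod (p x) \<le> (\<integral>c. cmod (h c) \<partial>\<nu>)" for x
    unfolding p_def by (rule inv_fourier_bound[OF haar_sets[OF haar(2)] h(1)])
  have bd: "integrable \<mu> (\<lambda>x. indicator K x * (cmod (F x - p x))\<^sup>2) \<and>
      (\<integral>x. indicator K x * (cmod (F x - p x))\<^sup>2 \<partial>\<mu>) \<le> B" if K: "compact K" for K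
  proof -
    have [measurable]: "K \<in> sets \<mu>" and Kfin: "emeasure \<mu> K < \<infinity>"
      using haar_compact[OF haar(1) K] by auto
    define g where "g x = indicator K x * (F x - p x)" for x
    \<comment> \<open>\<open>p\<close> is bounded and \<open>K\<close> has finite measure\<close>
    have "(\<lambda>x. (cmod (indicator K x))\<^sup>2) = indicator K"
      by (auto split: split_indicator)
    then have L2_1: "L2 \<mu> (\<lambda>x. indicator K x)"
      using Kfin by (simp add: L2_def less_top)
    have L2_F: "L2 \<mu> (\<lambda>x. indicator K x * F x)"
      by (rule L2_bound[OF _ F(2)]) (auto split: split_indicator)
    have L2_p: "L2 \<mu> (\<lambda>x. indicator K x * p x)"
      by (rule L2_bound[OF _ L2_cmult[OF L2_1, of "of_real (\<integral>c. cmod (h c) \<partial>\<nu>)"]])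
         (use p_bd in \<open>auto split: split_indicator intro: order_trans[OF _ abs_ge_self]\<close>)
    have L2_g: "L2 \<mu> g"
      using L2_diff[OF L2_F L2_p] unfolding g_def by (simp add: right_diff_distrib)
    have int_g: "integrable \<mu> g"
    proof -
      have "g = (\<lambda>x. indicator K x * g x)" by (auto simp: g_def split: split_indicator)
      then show ?thesis using L2_mult_integrable[OF L2_1 L2_g] by simp
    qed
    have sq_g: "(cmod (g x))\<^sup>2 = indicator K x * (cmod (F x - p x))\<^sup>2" for x
      by (auto simp: g_def split: split_indicator)
    note ghat = plancherel[OF int_g L2_g]
    note Fhat = plancherel(1)[OF F]
    have "complex_of_real (sqnorm \<mu> g) = (\<integral>x. F x * cnj (g x) - (indicator K x * p x) * cnj (g x) \<partial>\<mu>)"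
      unfolding integral_complex_of_real[symmetric] complex_norm_square
      by (intro Bochner_Integration.integral_cong)
         (auto simp: g_def algebra_simps split: split_indicator)
    also have "\<dots> = (\<integral>x. F x * cnj (g x) \<partial>\<mu>) - (\<integral>x. (indicator K x * p x) * cnj (g x) \<partial>\<mu>)"
      by (intro Bochner_Integration.integral_diff L2_cnj_integrable F L2_g L2_p)
    also have "(\<integral>x. (indicator K x * p x) * cnj (g x) \<partial>\<mu>) = (\<integral>x. p x * cnj (g x) \<partial>\<mu>)"
      by (intro Bochner_Integration.integral_cong) (auto simp: g_def split: split_indicator)
    also have "\<dots> = (\<integral>c. h c * cnj (fourier \<mu> g c) \<partial>\<nu>)"
      unfolding p_def
      by (rule inv_fourier_duality[OF lc haar(1,2) sf h(1) int_g K])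
         (use L2_measurable[OF ghat(1)] in \<open>auto simp: g_def\<close>)
    also have "(\<integral>x. F x * cnj (g x) \<partial>\<mu>) = (\<integral>c. fourier \<mu> F c * cnj (fourier \<mu> g c) \<partial>\<nu>)"
      by (rule parseval[OF F int_g L2_g])
    also have "\<dots> - (\<integral>c. h c * cnj (fourier \<mu> g c) \<partial>\<nu>) =
        (\<integral>c. (fourier \<mu> F c - h c) * cnj (fourier \<mu> g c) \<partial>\<nu>)"
      unfolding left_diff_distrib
      by (intro Bochner_Integration.integral_diff[symmetric] L2_cnj_integrable Fhat ghat(1) h(2))
    finally have "sqnorm \<mu> g = Re (\<integral>c. (fourier \<mu> F c - h c) * cnj (fourier \<mu> g c) \<partial>\<nu>)"
      by (metis Re_complex_of_real)
    \<comment> \<open>one of the two terms of the bound is again the squared norm of \<open>g\<close>, by Plancherel\<close>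
    with Re_inner_le[OF L2_diff[OF Fhat h(2)] ghat(1)] ghat(2)
    have "sqnorm \<mu> g \<le> B" unfolding B_def by linarith
    then show ?thesis using L2_integrable[OF L2_g] unfolding sq_g by blast
  qed
  note * = L2_diff_continuous_of_compact_bound[OF haar(1) p_cont F(2) bd]
  show "L2 \<mu> (\<lambda>x. F x - inv_fourier \<nu> h x)" using *(1) unfolding p_def .
  show "sqnorm \<mu> (\<lambda>x. F x - inv_fourier \<nu> h x) \<le> sqnorm \<nu> (\<lambda>c. fourier \<mu> F c - h c)"
    using *(2) unfolding p_def B_def .
qed

lemma is_L2_fourier_inv_fourier:
  assumes lc: "locally compact (UNIV :: 'a set)" and sf: "sigma_finite_measure \<nu>"
    and h: "integrable \<nu> h" "L2 \<nu> h"
  shows "is_L2_fourier \<mu> \<nu> (inv_fourier \<nu> h) h"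
proof -
  have "\<exists>f. integrable \<mu> f \<and> L2 \<mu> f \<and> sqnorm \<nu> (\<lambda>c. fourier \<mu> f c - h c) < 1 / Suc n" for n
    using fourier_dense[OF h(2), of "1 / Suc n"] by (metis zero_less_divide_1_iff of_nat_0_less_iff zero_less_Suc)
  then obtain F where F: "\<And>n. integrable \<mu> (F n)" "\<And>n. L2 \<mu> (F n)"
      "\<And>n. sqnorm \<nu> (\<lambda>c. fourier \<mu> (F n) c - h c) < 1 / Suc n" by metis
  have lim: "(\<lambda>n. sqnorm \<nu> (\<lambda>c. fourier \<mu> (F n) c - h c)) \<longlonglongrightarrow> 0"
    by (rule tendsto_sandwich[OF always_eventually always_eventually tendsto_const
          LIMSEQ_Suc[OF lim_1_over_n]]; intro allI integral_nonneg_AE less_imp_le[OF F(3)]) simp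
  note close = inv_fourier_close[OF lc sf h F(1,2)]
  have "L2 \<mu> (inv_fourier \<nu> h)"
    using L2_diff[OF F(2)[of 0] close(1)[of 0]] by simp
  moreover have "(\<lambda>n. sqnorm \<mu> (\<lambda>x. F n x - inv_fourier \<nu> h x)) \<longlonglongrightarrow> 0"
    by (rule tendsto_sandwich[OF always_eventually always_eventually tendsto_const lim];
        intro allI integral_nonneg_AE close(2)) simp
  ultimately show ?thesis
    unfolding is_L2_fourier_def using h(2) F(1,2) lim by blast
qed

lemma L2_fourier_inv_fourier:
  assumes "locally compact (UNIV :: 'a set)" "sigma_finite_measure \<nu>" "integrable \<nu> h" "L2 \<nu> h"
  shows "is_L2_fourier \<mu> \<nu> (inv_fourier \<nu> h) (L2_fourier \<mu> \<nu> (inv_fourier \<nu> h))"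
    and "AE c in \<nu>. L2_fourier \<mu> \<nu> (inv_fourier \<nu> h) c = h c"
proof -
  note * = is_L2_fourier_inv_fourier[OF assms]
  show **: "is_L2_fourier \<mu> \<nu> (inv_fourier \<nu> h) (L2_fourier \<mu> \<nu> (inv_fourier \<nu> h))"
    unfolding L2_fourier_def by (rule someI[of _ h]) (rule *)
  show "AE c in \<nu>. L2_fourier \<mu> \<nu> (inv_fourier \<nu> h) c = h c"
    by (rule is_L2_fourier_unique[OF ** *])
qed

end

section \<open>Harmonic Hilbert spaces\<close>

text \<open>If \<open>w c < 1\<close>, submultiplicativity gives \<open>ln (w (n c)) \<le> n ln (w c)\<close>, and the
  Beurling--Domar series at \<open>c\<close> lies termwise below a negative multiple of the
  harmonic series.\<close>

lemma beurling_domar_weight_ge_1: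
  assumes w: "submultiplicative_weight w" and bd: "beurling_domar w"
  shows "1 \<le> w c"
proof (rule ccontr)
  assume "\<not> 1 \<le> w c"
  have pos: "w d > 0" and sub: "w (d + d') \<le> w d * w d'" for d d'
    using w unfolding submultiplicative_weight_def by auto
  define l where "l = - ln (w c)"
  have l: "l > 0" using \<open>\<not> 1 \<le> w c\<close> pos[of c] by (simp add: l_def)
  have pow: "w (\<Sum>i<Suc n. c) \<le> w c ^ Suc n" for n
  proof (induction n)
    case (Suc n)
    have "w (\<Sum>i<Suc (Suc n). c) \<le> w (\<Sum>i<Suc n. c) * w c"
      using sub[of "\<Sum>i<Suc n. c" c] by simp
    also have "\<dots> \<le> w c ^ Suc n * w c" using Suc pos[of c] by (intro mult_right_mono) auto
    finally show ?case by (simp add: mult.commute)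
  qed simp
  have le: "inverse (real (Suc n)) \<le> - (ln (w (\<Sum>i<Suc n. c)) / (real (Suc n))\<^sup>2) / l" for n
  proof -
    have "ln (w (\<Sum>i<Suc n. c)) \<le> ln (w c ^ Suc n)" using pow[of n] pos by (simp only: ln_le_cancel_iff zero_less_power)
    also have "\<dots> = real (Suc n) * - l" using pos[of c] by (simp only: ln_realpow l_def minus_minus)
    finally have "real (Suc n) * l / (real (Suc n))\<^sup>2 \<le> - ln (w (\<Sum>i<Suc n. c)) / (real (Suc n))\<^sup>2"
      by (intro divide_right_mono) auto
    then show ?thesis using l by (simp add: field_simps power2_eq_square del: sum.lessThan_Suc of_nat_Suc)
  qed
  have "summable (\<lambda>n. - (ln (w (\<Sum>i<Suc n. c)) / (real (Suc n))\<^sup>2) / l)"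
    using bd unfolding beurling_domar_def by (intro summable_divide summable_minus) blast
  then have "summable (\<lambda>n. inverse (real (Suc n)))"
    by (rule summable_comparison_test'[where N = 0]) (use le in auto)
  then show False using not_summable_harmonic[where 'a = real]
      summable_Suc_iff[of "\<lambda>n. inverse (real n)"] by blast
qed

text \<open>Uniqueness of the representing element: if \<open>g\<close> and \<open>k x\<close> both represent evaluation at \<open>x\<close>,
  their difference is orthogonal to itself.\<close>

lemma reproducing_kernelI:
  assumes H: "hilbert_function_space H ip"
    and k: "\<And>x. k x \<in> H" "\<And>x f. f \<in> H \<Longrightarrow> f x = ip f (k x)"
  shows "reproducing_kernel H ip k"
  unfolding reproducing_kernel_def
proof (intro allI conjI ballI impI)
  fix x g assume g: "g \<in> H" "\<forall>f\<in>H. f x = ip f g"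
  have add: "(\<lambda>x. f x + f' x) \<in> H" "ip (\<lambda>x. f x + f' x) h = ip f h + ip f' h"
    and mult: "(\<lambda>x. a * f x) \<in> H" "ip (\<lambda>x. a * f x) h = a * ip f h"
    and herm: "ip f' f = cnj (ip f f')"
    if "f \<in> H" "f' \<in> H" "h \<in> H" for f f' h a
    using H that unfolding hilbert_function_space_def by blast+
  have zero: "f = (\<lambda>_. 0)" if "f \<in> H" "ip f f = 0" for f
    using H that unfolding hilbert_function_space_def by blast
  define d where "d = (\<lambda>y. g y + (-1) * k x y)"
  have m: "(\<lambda>y. (-1) * k x y) \<in> H" by (rule mult(1)[OF k(1) k(1) k(1)])
  have d: "d \<in> H" unfolding d_def by (rule add(1)[OF g(1) m m])
  have "ip d d = ip g d + (-1) * ip (k x) d"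
    unfolding d_def by (simp only: add(2)[OF g(1) m d[unfolded d_def]] mult(2)[OF k(1) d d, unfolded d_def])
  also have "ip g d = cnj (d x)" using herm[OF d g(1) d] g(2) d by simp
  also have "ip (k x) d = cnj (d x)" using herm[OF d k(1) d] k(2)[OF d, of x] by simp
  finally have "d = (\<lambda>_. 0)" using zero[OF d] by simp
  then show "g = k x" by (auto simp: d_def fun_eq_iff)
qed (use k in auto)

context
  fixes \<mu> :: "'a::{topological_ab_group_add, t2_space} measure"
    and \<nu> :: "'a dual_group measure"
    and w :: "'a dual_group \<Rightarrow> real"
  assumes lc: "locally compact (UNIV :: 'a set)"
    and haar: "haar_measure \<mu>" "haar_measure \<nu>"
    and norm: "fourier_normalized \<mu> \<nu>"
    and weight: "continuous_on UNIV w" "\<And>c. 1 \<le> w c"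
    and inv_weight: "L2 \<nu> (\<lambda>c. complex_of_real (inverse (w c)))"
begin

lemma weight_nonzero [simp]: "w c \<noteq> 0"
  using weight(2)[of c] by auto

lemma weight_measurable [measurable]: "w \<in> borel_measurable \<nu>"
  using borel_measurable_continuous_onI[OF weight(1)] haar_measurable[OF haar(2)] by auto

text \<open>The positive function \<open>w\<^sup>-\<^sup>1\<close> is square integrable, so the sets \<open>{w\<^sup>-\<^sup>1 > 1/n}\<close> have finite
  measure, and they cover the dual group.\<close>

lemma sigma_finite_dual: "sigma_finite_measure \<nu>"
proof
  define A where "A n = {c \<in> space \<nu>. 1 / real (Suc n) < cmod (complex_of_real (inverse (w c)))}" for n
  have [measurable]: "(\<lambda>c. complex_of_real (inverse (w c))) \<in> borel_measurable \<nu>"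
    by (rule L2_measurable[OF inv_weight])
  have "A n \<in> sets \<nu>" for n unfolding A_def by measurable
  moreover have "(\<Union>n. A n) = space \<nu>"
  proof -
    have "\<exists>n. 1 / real (Suc n) < cmod (complex_of_real (inverse (w c)))" for c
      using reals_Archimedean[of "cmod (complex_of_real (inverse (w c)))"]
      by (auto simp: inverse_eq_divide)
    then show ?thesis unfolding A_def by blast
  qed
  moreover have "emeasure \<nu> (A n) \<noteq> \<infinity>" for n
    using L2_level_set_finite[OF inv_weight, of n] by (simp add: A_def less_top)
  ultimately show "\<exists>A. countable A \<and> A \<subseteq> sets \<nu> \<and> \<Union> A = space \<nu> \<and> (\<forall>a\<in>A. emeasure \<nu> a \<noteq> \<infinity>)"
    by (intro exI[of _ "range A"]) auto
qed

lemma weighted_L2_times_weight: "h \<in> L2_weighted \<nu> w \<Longrightarrow> L2 \<nu> (\<lambda>c. h c * complex_of_real (w c))"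
  by (simp add: L2_weighted_def)

lemma weightedI:
  assumes "h \<in> borel_measurable \<nu>" "L2 \<nu> (\<lambda>c. h c * complex_of_real (w c))"
  shows "h \<in> L2_weighted \<nu> w"
  using assms by (simp add: L2_weighted_def)

lemma weighted_measurable [measurable_dest]: "h \<in> L2_weighted \<nu> w \<Longrightarrow> h \<in> borel_measurable \<nu>"
  by (simp add: L2_weighted_def)

lemma weighted_L2:
  assumes "h \<in> L2_weighted \<nu> w"
  shows "L2 \<nu> h"
proof (rule L2_bound[OF weighted_measurable[OF assms] weighted_L2_times_weight[OF assms]])
  have "cmod (h c) * 1 \<le> cmod (h c) * \<bar>w c\<bar>" for c
    using weight(2)[of c] by (intro mult_left_mono) auto
  then show "AE c in \<nu>. cmod (h c) \<le> cmod (h c * complex_of_real (w c))"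
    by (simp add: norm_mult)
qed

text \<open>\<open>h = (h w) w\<^sup>-\<^sup>1\<close> is a product of square integrable functions.\<close>

lemma weighted_integrable:
  assumes "h \<in> L2_weighted \<nu> w"
  shows "integrable \<nu> h"
  using L2_mult_integrable[OF weighted_L2_times_weight[OF assms] inv_weight]
  by (simp add: mult.assoc of_real_mult[symmetric] del: of_real_mult)

lemma weighted_add: "h \<in> L2_weighted \<nu> w \<Longrightarrow> k \<in> L2_weighted \<nu> w \<Longrightarrow> (\<lambda>c. h c + k c) \<in> L2_weighted \<nu> w"
  by (auto simp: L2_weighted_def distrib_right intro: L2_add)

lemma weighted_cmult: "h \<in> L2_weighted \<nu> w \<Longrightarrow> (\<lambda>c. a * h c) \<in> L2_weighted \<nu> w"
  by (auto simp: L2_weighted_def mult.assoc intro: L2_cmult)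

lemma weighted_diff: "h \<in> L2_weighted \<nu> w \<Longrightarrow> k \<in> L2_weighted \<nu> w \<Longrightarrow> (\<lambda>c. h c - k c) \<in> L2_weighted \<nu> w"
  using weighted_add[of h "\<lambda>c. -1 * k c"] weighted_cmult[of k "-1"] by simp

lemma inv_fourier_weighted_add:
  "h \<in> L2_weighted \<nu> w \<Longrightarrow> k \<in> L2_weighted \<nu> w \<Longrightarrow>
    inv_fourier \<nu> (\<lambda>c. h c + k c) x = inv_fourier \<nu> h x + inv_fourier \<nu> k x"
  by (intro inv_fourier_add haar_sets haar weighted_integrable)

lemma inv_fourier_weighted_diff:
  "h \<in> L2_weighted \<nu> w \<Longrightarrow> k \<in> L2_weighted \<nu> w \<Longrightarrow>
    inv_fourier \<nu> (\<lambda>c. h c - k c) x = inv_fourier \<nu> h x - inv_fourier \<nu> k x"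
  using inv_fourier_weighted_add[of h "\<lambda>c. -1 * k c" x] weighted_cmult[of k "-1"]
    inv_fourier_cmult[of \<nu> "-1" k x] by simp

lemma harmonic_spaceE:
  assumes "f \<in> harmonic_space \<nu> w"
  obtains h where "h \<in> L2_weighted \<nu> w" "f = inv_fourier \<nu> h"
  using assms by (auto simp: harmonic_space_def)

lemma harmonic_spaceI: "h \<in> L2_weighted \<nu> w \<Longrightarrow> inv_fourier \<nu> h \<in> harmonic_space \<nu> w"
  by (simp add: harmonic_space_def)

text \<open>This is where the Fourier theory enters: the inner product refers to a chosen extended Fourier
  transform, which recovers \<open>h\<close> almost everywhere.\<close>

lemma harmonic_inner_inv_fourier:
  assumes h: "h \<in> L2_weighted \<nu> w" and k: "k \<in> L2_weighted \<nu> w"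
  shows "harmonic_inner \<mu> \<nu> w (inv_fourier \<nu> h) (inv_fourier \<nu> k) =
    (\<integral>c. (h c * complex_of_real (w c)) * cnj (k c * complex_of_real (w c)) \<partial>\<nu>)"
proof -
  note H = L2_fourier_inv_fourier[OF haar norm lc sigma_finite_dual weighted_integrable[OF h] weighted_L2[OF h]]
  note K = L2_fourier_inv_fourier[OF haar norm lc sigma_finite_dual weighted_integrable[OF k] weighted_L2[OF k]]
  have L: "L2 \<nu> (L2_fourier \<mu> \<nu> (inv_fourier \<nu> h))" "L2 \<nu> (L2_fourier \<mu> \<nu> (inv_fourier \<nu> k))"
    using H(1) K(1) by (simp_all add: is_L2_fourier_def)
  note [measurable] = L2_measurable[OF L(1)] L2_measurable[OF L2_cnj[OF L(2)]]
    L2_measurable[OF weighted_L2_times_weight[OF h]] L2_measurable[OF L2_cnj[OF weighted_L2_times_weight[OF k]]]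
  show ?thesis unfolding harmonic_inner_def
  proof (rule integral_cong_AE)
    show "AE c in \<nu>. L2_fourier \<mu> \<nu> (inv_fourier \<nu> h) c * cnj (L2_fourier \<mu> \<nu> (inv_fourier \<nu> k) c) *
          complex_of_real ((w c)\<^sup>2) =
        (h c * complex_of_real (w c)) * cnj (k c * complex_of_real (w c))"
      using H(2) K(2) by eventually_elim (simp add: power2_eq_square)
  qed measurable
qed

lemma harmonic_inner_self:
  assumes "h \<in> L2_weighted \<nu> w"
  shows "harmonic_inner \<mu> \<nu> w (inv_fourier \<nu> h) (inv_fourier \<nu> h) =
    complex_of_real (sqnorm \<nu> (\<lambda>c. h c * complex_of_real (w c)))"
  unfolding harmonic_inner_inv_fourier[OF assms assms] complex_norm_square[symmetric]
  by (rule integral_complex_of_real)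

lemma harmonic_dist:
  assumes "h \<in> L2_weighted \<nu> w" "k \<in> L2_weighted \<nu> w"
  shows "ip_dist (harmonic_inner \<mu> \<nu> w) (inv_fourier \<nu> h) (inv_fourier \<nu> k) =
    sqrt (sqnorm \<nu> (\<lambda>c. h c * complex_of_real (w c) - k c * complex_of_real (w c)))"
proof -
  have "(\<lambda>x. inv_fourier \<nu> h x - inv_fourier \<nu> k x) = inv_fourier \<nu> (\<lambda>c. h c - k c)"
    using inv_fourier_weighted_diff[OF assms] by auto
  then show ?thesis
    using harmonic_inner_self[OF weighted_diff[OF assms]] by (simp add: ip_dist_def left_diff_distrib)
qed

text \<open>Multiplication by \<open>w\<close> identifies the spectra with all square integrable functions, so
  completeness is that of \<open>L\<^sup>2\<close>.\<close>

lemma harmonic_complete: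
  assumes F: "\<And>n::nat. F n \<in> harmonic_space \<nu> w"
    and cauchy: "\<And>e. e > 0 \<Longrightarrow> \<exists>N. \<forall>m\<ge>N. \<forall>n\<ge>N. ip_dist (harmonic_inner \<mu> \<nu> w) (F m) (F n) < e"
  shows "\<exists>f\<in>harmonic_space \<nu> w. (\<lambda>n. ip_dist (harmonic_inner \<mu> \<nu> w) (F n) f) \<longlonglongrightarrow> 0"
proof -
  have "\<exists>h. h \<in> L2_weighted \<nu> w \<and> F n = inv_fourier \<nu> h" for n
    using F[of n] by (auto simp: harmonic_space_def)
  then obtain h where h: "\<And>n. h n \<in> L2_weighted \<nu> w" "\<And>n. F n = inv_fourier \<nu> (h n)" by metis
  have cau: "\<exists>N. \<forall>m\<ge>N. \<forall>n\<ge>N.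
      sqnorm \<nu> (\<lambda>c. h m c * complex_of_real (w c) - h n c * complex_of_real (w c)) < e" if "e > 0" for e
    using cauchy[of "sqrt e"] that unfolding h(2) harmonic_dist[OF h(1) h(1)] real_sqrt_less_iff by simp
  then obtain u where u: "L2 \<nu> u" "(\<lambda>n. sqnorm \<nu> (\<lambda>c. h n c * complex_of_real (w c) - u c)) \<longlonglongrightarrow> 0"
    using L2_complete[of \<nu> "\<lambda>n c. h n c * complex_of_real (w c)",
        OF weighted_L2_times_weight[OF h(1)] cau] by blast
  define g where "g c = u c / complex_of_real (w c)" for c
  have gw: "g c * complex_of_real (w c) = u c" for c by (simp add: g_def)
  have "g \<in> L2_weighted \<nu> w"
  proof (rule weightedI)
    show "g \<in> borel_measurable \<nu>" unfolding g_def using L2_measurable[OF u(1)] by measurable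
    show "L2 \<nu> (\<lambda>c. g c * complex_of_real (w c))" unfolding gw by (rule u(1))
  qed
  moreover have "(\<lambda>n. ip_dist (harmonic_inner \<mu> \<nu> w) (F n) (inv_fourier \<nu> g)) \<longlonglongrightarrow> 0"
    using tendsto_real_sqrt[OF u(2)] unfolding h(2) harmonic_dist[OF h(1) calculation] gw by simp
  ultimately show ?thesis by (intro bexI[OF _ harmonic_spaceI])
qed

lemma harmonic_hilbert_function_space:
  "hilbert_function_space (harmonic_space \<nu> w) (harmonic_inner \<mu> \<nu> w)"
  unfolding hilbert_function_space_def
proof (intro conjI allI ballI impI)
  let ?H = "harmonic_space \<nu> w" and ?ip = "harmonic_inner \<mu> \<nu> w"
  have add_eq: "(\<lambda>x. inv_fourier \<nu> h x + inv_fourier \<nu> k x) = inv_fourier \<nu> (\<lambda>c. h c + k c)"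
    if "h \<in> L2_weighted \<nu> w" "k \<in> L2_weighted \<nu> w" for h k
    using inv_fourier_weighted_add[OF that] by auto
  have cmult_eq: "(\<lambda>x. a * inv_fourier \<nu> h x) = inv_fourier \<nu> (\<lambda>c. a * h c)" for a h
    using inv_fourier_cmult[of \<nu> a h] by auto
  have zero: "(\<lambda>_. 0) \<in> L2_weighted \<nu> w" by (simp add: L2_weighted_def L2_def)
  have "inv_fourier \<nu> (\<lambda>_. 0) = (\<lambda>_. 0)" by (simp add: inv_fourier_def fun_eq_iff)
  with harmonic_spaceI[OF zero] show "(\<lambda>_. 0) \<in> ?H" by simp
  fix f g assume f: "f \<in> ?H" and g: "g \<in> ?H"
  obtain h where h: "h \<in> L2_weighted \<nu> w" "f = inv_fourier \<nu> h" using f by (rule harmonic_spaceE)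
  obtain k where k: "k \<in> L2_weighted \<nu> w" "g = inv_fourier \<nu> k" using g by (rule harmonic_spaceE)
  show "(\<lambda>x. f x + g x) \<in> ?H"
    unfolding h k add_eq[OF h(1) k(1)] by (intro harmonic_spaceI weighted_add h k)
  show "(\<lambda>x. a * f x) \<in> ?H" for a
    unfolding h cmult_eq by (intro harmonic_spaceI weighted_cmult h)
  show "?ip (\<lambda>x. a * f x) g = a * ?ip f g" for a
    unfolding h(2) k(2) cmult_eq harmonic_inner_inv_fourier[OF weighted_cmult[OF h(1)] k(1)]
      harmonic_inner_inv_fourier[OF h(1) k(1)] mult.assoc by (rule integral_mult_right_zero)
  show "?ip g f = cnj (?ip f g)"
    unfolding h(2) k(2) harmonic_inner_inv_fourier[OF h(1) k(1)] harmonic_inner_inv_fourier[OF k(1) h(1)]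
    by (subst Bochner_Integration.integral_cnj[symmetric]) (simp add: mult_ac)
  show "0 \<le> Re (?ip f f)"
    unfolding h(2) harmonic_inner_self[OF h(1)] by (simp add: integral_nonneg_AE)
  show "f = (\<lambda>_. 0)" if "?ip f f = 0"
  proof -
    have "sqnorm \<nu> (\<lambda>c. h c * complex_of_real (w c)) = 0"
      using that unfolding h(2) harmonic_inner_self[OF h(1)] by (simp only: of_real_eq_0_iff)
    from sqnorm_eq_0_AE[OF weighted_L2_times_weight[OF h(1)] this] have "AE c in \<nu>. h c = 0" by simp
    then have "inv_fourier \<nu> h x = 0" for x
      unfolding inv_fourier_def by (intro integral_eq_zero_AE) (auto elim!: eventually_mono)
    then show ?thesis using h(2) by auto
  qed
  fix f' assume "f' \<in> ?H"
  then obtain j where j: "j \<in> L2_weighted \<nu> w" "f' = inv_fourier \<nu> j" by (rule harmonic_spaceE)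
  show "?ip (\<lambda>x. f x + g x) f' = ?ip f f' + ?ip g f'"
    unfolding h(2) k(2) j(2) add_eq[OF h(1) k(1)] harmonic_inner_inv_fourier[OF weighted_add[OF h(1) k(1)] j(1)]
      harmonic_inner_inv_fourier[OF h(1) j(1)] harmonic_inner_inv_fourier[OF k(1) j(1)] distrib_right
    by (intro Bochner_Integration.integral_add L2_cnj_integrable weighted_L2_times_weight h j k)
next
  fix F assume F: "(\<forall>n::nat. F n \<in> harmonic_space \<nu> w) \<and>
    (\<forall>e>0. \<exists>N. \<forall>m\<ge>N. \<forall>n\<ge>N. ip_dist (harmonic_inner \<mu> \<nu> w) (F m) (F n) < e)"
  show "\<exists>f\<in>harmonic_space \<nu> w. (\<lambda>n. ip_dist (harmonic_inner \<mu> \<nu> w) (F n) f) \<longlonglongrightarrow> 0"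
    by (rule harmonic_complete) (use F in blast)+
qed

text \<open>The spectrum of the translated kernel: translation by \<open>x\<close> is multiplication by the conjugate of
  evaluation at \<open>x\<close>.\<close>

definition kernel_spectrum :: "'a \<Rightarrow> 'a dual_group \<Rightarrow> complex" where
  "kernel_spectrum x c = complex_of_real (inverse ((w c)\<^sup>2)) * cnj (pairing c x)"

lemma kernel_spectrum_times_weight:
  "kernel_spectrum x c * complex_of_real (w c) = complex_of_real (inverse (w c)) * cnj (pairing c x)"
  by (simp add: kernel_spectrum_def power2_eq_square)

lemma kernel_spectrum_weighted: "kernel_spectrum x \<in> L2_weighted \<nu> w"
proof (rule weightedI)
  note [measurable] = evaluation_measurable[OF haar_sets[OF haar(2)], of x]
  have [measurable]: "(\<lambda>c. cnj (pairing c x)) \<in> borel_measurable \<nu>"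
    by (rule borel_measurable_continuous_on[OF continuous_on_cnj[OF continuous_on_id]]) measurable
  show "kernel_spectrum x \<in> borel_measurable \<nu>" unfolding kernel_spectrum_def by measurable
  have "(\<lambda>c. complex_of_real (inverse (w c)) * cnj (pairing c x)) \<in> borel_measurable \<nu>" by measurable
  then show "L2 \<nu> (\<lambda>c. kernel_spectrum x c * complex_of_real (w c))"
    unfolding kernel_spectrum_times_weight
    by (rule L2_bound[OF _ inv_weight]) (simp add: norm_mult)
qed

lemma inv_fourier_kernel_spectrum:
  "inv_fourier \<nu> (kernel_spectrum x) y =
    inv_fourier \<nu> (\<lambda>c. complex_of_real (inverse ((w c)\<^sup>2))) (y - x)"
  unfolding inv_fourier_def kernel_spectrum_def
  by (intro Bochner_Integration.integral_cong) (simp_all add: pairing_diff_right mult_ac)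

lemma reproducing_property:
  assumes "f \<in> harmonic_space \<nu> w"
  shows "f x = harmonic_inner \<mu> \<nu> w f (inv_fourier \<nu> (kernel_spectrum x))"
proof -
  obtain h where h: "h \<in> L2_weighted \<nu> w" "f = inv_fourier \<nu> h" using assms by (rule harmonic_spaceE)
  have eq: "(h c * complex_of_real (w c)) * cnj (kernel_spectrum x c * complex_of_real (w c)) = h c * pairing c x" for c
    unfolding kernel_spectrum_times_weight by simp
  show ?thesis
    unfolding h(2) harmonic_inner_inv_fourier[OF h(1) kernel_spectrum_weighted] eq
    by (simp only: inv_fourier_def)
qed

text \<open>Point evaluation at \<open>x\<close> is the inner product with the kernel function, and the Cauchy-Schwarz
  inequality bounds it.\<close>

lemma harmonic_evaluation_bound:
  assumes "f \<in> harmonic_space \<nu> w" "g \<in> harmonic_space \<nu> w"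
  shows "cmod (g x - f x) \<le> ip_dist (harmonic_inner \<mu> \<nu> w) g f *
    sqrt (sqnorm \<nu> (\<lambda>c. kernel_spectrum x c * complex_of_real (w c)))"
proof -
  obtain h where h: "h \<in> L2_weighted \<nu> w" "f = inv_fourier \<nu> h" using assms(1) by (rule harmonic_spaceE)
  obtain k where k: "k \<in> L2_weighted \<nu> w" "g = inv_fourier \<nu> k" using assms(2) by (rule harmonic_spaceE)
  note d = weighted_diff[OF k(1) h(1)]
  have "g x - f x = inv_fourier \<nu> (\<lambda>c. k c - h c) x"
    unfolding h k by (rule inv_fourier_weighted_diff[OF k(1) h(1), symmetric])
  also have "\<dots> = (\<integral>c. ((k c - h c) * complex_of_real (w c)) * cnj (kernel_spectrum x c * complex_of_real (w c)) \<partial>\<nu>)"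
    unfolding harmonic_inner_inv_fourier[OF d kernel_spectrum_weighted, symmetric]
    by (rule reproducing_property[OF harmonic_spaceI[OF d]])
  finally have "(cmod (g x - f x))\<^sup>2 \<le> sqnorm \<nu> (\<lambda>c. (k c - h c) * complex_of_real (w c)) *
      sqnorm \<nu> (\<lambda>c. cnj (kernel_spectrum x c * complex_of_real (w c)))"
    using cauchy_schwarz_L2[OF weighted_L2_times_weight[OF d]
        L2_cnj[OF weighted_L2_times_weight[OF kernel_spectrum_weighted]], of x] by simp
  then have "cmod (g x - f x) \<le> sqrt (sqnorm \<nu> (\<lambda>c. (k c - h c) * complex_of_real (w c)) *
      sqnorm \<nu> (\<lambda>c. kernel_spectrum x c * complex_of_real (w c)))"
    by (intro real_le_rsqrt) (simp only: complex_mod_cnj)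
  then show ?thesis
    unfolding h(2) k(2) harmonic_dist[OF k(1) h(1)] by (simp only: real_sqrt_mult left_diff_distrib)
qed

lemma harmonic_RKHS: "RKHS (harmonic_space \<nu> w) (harmonic_inner \<mu> \<nu> w)"
  unfolding RKHS_def
proof (intro conjI allI ballI impI)
  show "hilbert_function_space (harmonic_space \<nu> w) (harmonic_inner \<mu> \<nu> w)"
    by (rule harmonic_hilbert_function_space)
next
  fix f assume "f \<in> harmonic_space \<nu> w"
  then obtain h where "h \<in> L2_weighted \<nu> w" "f = inv_fourier \<nu> h" by (rule harmonic_spaceE)
  then show "continuous_on UNIV f"
    using inv_fourier_continuous[OF lc haar(2) sigma_finite_dual] weighted_integrable by blast
next
  fix x f and e :: real assume f: "f \<in> harmonic_space \<nu> w" and e: "e > 0"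
  define S where "S = sqrt (sqnorm \<nu> (\<lambda>c. kernel_spectrum x c * complex_of_real (w c)))"
  have S: "S \<ge> 0" by (simp add: S_def integral_nonneg_AE)
  have "cmod (g x - f x) < e"
    if g: "g \<in> harmonic_space \<nu> w" and less: "ip_dist (harmonic_inner \<mu> \<nu> w) g f < e / (S + 1)" for g
  proof -
    have "cmod (g x - f x) \<le> ip_dist (harmonic_inner \<mu> \<nu> w) g f * S"
      unfolding S_def by (rule harmonic_evaluation_bound[OF f g])
    also have "\<dots> \<le> e / (S + 1) * S" using less S by (intro mult_right_mono) auto
    also have "\<dots> < e" using e S by (simp add: field_simps)
    finally show ?thesis .
  qed
  then show "\<exists>d>0. \<forall>g\<in>harmonic_space \<nu> w. ip_dist (harmonic_inner \<mu> \<nu> w) g f < d \<longrightarrow> cmod (g x - f x) < e"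
    using e S by (intro exI[of _ "e / (S + 1)"]) auto
qed

end

theorem proposition4p3:
  fixes \<mu> :: "'a::{topological_ab_group_add, t2_space} measure"
    and \<nu> :: "'a dual_group measure"
    and w :: "'a dual_group \<Rightarrow> real"
    and \<phi> :: "'a \<Rightarrow> complex"
  assumes "locally compact (UNIV :: 'a set)"
    and "haar_measure \<mu>" and "haar_measure \<nu>"
    and "fourier_normalized \<mu> \<nu>"
    and "submultiplicative_weight w"
    and "beurling_domar w"
    and "L2 \<nu> (\<lambda>c. complex_of_real (inverse (w c)))"
    and "\<phi> = inv_fourier \<nu> (\<lambda>c. complex_of_real (inverse ((w c)\<^sup>2)))"
  shows "RKHS (harmonic_space \<nu> w) (harmonic_inner \<mu> \<nu> w) \<and>
    reproducing_kernel (harmonic_space \<nu> w) (harmonic_inner \<mu> \<nu> w) (\<lambda>x y. \<phi> (y - x)) \<and>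
    (\<forall>x. translate x \<phi> \<in> harmonic_space \<nu> w) \<and>
    (\<forall>f\<in>harmonic_space \<nu> w. \<forall>x. f x = harmonic_inner \<mu> \<nu> w f (translate x \<phi>))"
proof -
  have "continuous_on UNIV w" using assms(5) by (simp add: submultiplicative_weight_def)
  note setting = assms(1-4) this beurling_domar_weight_ge_1[OF assms(5,6)] assms(7)
  have \<phi>: "(\<lambda>y. \<phi> (y - x)) = inv_fourier \<nu> (kernel_spectrum w x)" for x
    using inv_fourier_kernel_spectrum[OF setting] assms(8) by auto
  have mem: "(\<lambda>y. \<phi> (y - x)) \<in> harmonic_space \<nu> w" for x
    unfolding \<phi> by (rule harmonic_spaceI[OF setting kernel_spectrum_weighted[OF setting]])
  have rep: "f x = harmonic_inner \<mu> \<nu> w f (\<lambda>y. \<phi> (y - x))" if "f \<in> harmonic_space \<nu> w" for f x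
    unfolding \<phi> by (rule reproducing_property[OF setting that])
  have "reproducing_kernel (harmonic_space \<nu> w) (harmonic_inner \<mu> \<nu> w) (\<lambda>x y. \<phi> (y - x))"
    by (rule reproducing_kernelI[OF harmonic_hilbert_function_space[OF setting] mem rep])
  then show ?thesis
    using harmonic_RKHS[OF setting] mem rep by (simp add: translate_def)
qed

end
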